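(* Let $N\ge2$, $0<\alpha<N$, let $\Omega\subseteq\mathbb{R}^N$ be a bounded open set, let $H$ be a polarizer, and let $P_H(\Omega)$ be the corresponding polarized domain. Then $$\lambda_1(\Omega)\le\lambda_1(P_H(\Omega)).$$ Furthermore, equality holds only if $P_H(\Omega)\cong\Omega$ or $P_H(\Omega)\cong\sigma_H(\Omega)$.
   Context: For a bounded open set $\Omega\subseteq\mathbb{R}^N$, $N\ge2$, and $0<\alpha<N$, the Riesz potential operator on $L^2(\Omega)$ is $\mathcal{R}u(x)=\int_\Omega\frac{u(y)}{|x-y|^{N-\alpha}}\,dy$; it is positive, self-adjoint and compact. Its largest eigenvalue is $\lambda_1(\Omega)=\sup\left\{\int_\Omega\int_\Omega\frac{u(x)u(y)}{|x-y|^{N-\alpha}}\,dx\,dy:\ u\in L^2(\Omega),\ \|u\|_{L^2(\Omega)}=1\right\}$. A polarizer $H$ is an open affine half-space of $\mathbb{R}^N$; $\sigma_H$ denotes the reflection with respect to the boundary $\partial H$. The polarization of $\Omega$ with respect to $H$ is $P_H(\Omega)=[(\Omega\cup\sigma_H(\Omega))\cap H]\cup[\Omega\cap\sigma_H(\Omega)]$. For measurable sets $A,B$, $A\cong B$ ("almost equal") means $|A\triangle B|=0$, where $\triangle$ is the symmetric difference and $|\cdot|$ is Lebesgue measure. *)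

theory Defs
  imports "HOL-Analysis.Analysis"
begin

text \<open>Real-valued representatives of the elements of \<open>L\<^sup>2(\<Omega>)\<close>; values outside
  \<open>\<Omega>\<close> are irrelevant.\<close>

definition square_integrable_on :: "('a::euclidean_space \<Rightarrow> real) \<Rightarrow> 'a set \<Rightarrow> bool"
    (infixr "square'_integrable'_on" 46) where
  "u square_integrable_on \<Omega> \<longleftrightarrow>
     u \<in> borel_measurable (lebesgue_on \<Omega>) \<and> integrable (lebesgue_on \<Omega>) (\<lambda>x. (u x)\<^sup>2)"

definition L2norm_on :: "'a::euclidean_space set \<Rightarrow> ('a \<Rightarrow> real) \<Rightarrow> real" where
  "L2norm_on \<Omega> u = sqrt (LINT x|lebesgue_on \<Omega>. (u x)\<^sup>2)"

text \<open>The quadratic form of the Riesz potential operator on \<open>L\<^sup>2(\<Omega>)\<close>. On the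
  diagonal, a null set, the kernel has the value \<open>0\<close> by the conventions for
  \<open>powr\<close> and division.\<close>

definition riesz_energy :: "real \<Rightarrow> 'a::euclidean_space set \<Rightarrow> ('a \<Rightarrow> real) \<Rightarrow> real" where
  "riesz_energy \<alpha> \<Omega> u =
     (LINT y|lebesgue_on \<Omega>. LINT x|lebesgue_on \<Omega>.
        u x * u y / norm (x - y) powr (real DIM('a) - \<alpha>))"

text \<open>The largest eigenvalue of the Riesz potential operator, given by its variational
  formula. For nonempty bounded open \<open>\<Omega>\<close> and \<open>0 < \<alpha> < N\<close> the set is nonempty and bounded
  above; for \<open>\<Omega> = {}\<close> it is empty.\<close>

definition riesz_lambda1 :: "real \<Rightarrow> 'a::euclidean_space set \<Rightarrow> real" where
  "riesz_lambda1 \<alpha> \<Omega> =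
     Sup {riesz_energy \<alpha> \<Omega> u | u. u square_integrable_on \<Omega> \<and> L2norm_on \<Omega> u = 1}"

definition polarizer :: "'a::euclidean_space set \<Rightarrow> bool" where
  "polarizer H \<longleftrightarrow> (\<exists>a b. a \<noteq> 0 \<and> H = {x. a \<bullet> x < b})"

text \<open>Reflection in the hyperplane \<open>frontier H\<close>: the midpoint of \<open>x\<close> and its image is
  the orthogonal projection of \<open>x\<close> onto the hyperplane.\<close>

definition reflect_bdry :: "'a::euclidean_space set \<Rightarrow> 'a \<Rightarrow> 'a" where
  "reflect_bdry H x = 2 *\<^sub>R closest_point (frontier H) x - x"

lemma reflect_bdry_halfspace:
  fixes a :: "'a::euclidean_space"
  assumes "a \<noteq> 0"
  shows "reflect_bdry {x. a \<bullet> x < b} x = x - (2 * (a \<bullet> x - b) / (a \<bullet> a)) *\<^sub>R a"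
proof -
  define p where "p = x - ((a \<bullet> x - b) / (a \<bullet> a)) *\<^sub>R a"
  have fr: "frontier {x. a \<bullet> x < b} = {x. a \<bullet> x = b}"
    using assms by (simp add: frontier_halfspace_lt)
  have ap: "a \<bullet> p = b"
    using assms by (simp add: p_def inner_diff_right)
  have cp: "p = closest_point {x. a \<bullet> x = b} x"
  proof (rule closest_point_unique)
    show "convex {x. a \<bullet> x = b}" by (rule convex_hyperplane)
    show "closed {x. a \<bullet> x = b}" by (rule closed_hyperplane)
    show "p \<in> {x. a \<bullet> x = b}" using ap by simp
    show "\<forall>z\<in>{x. a \<bullet> x = b}. dist x p \<le> dist x z"
    proof
      fix z assume "z \<in> {x. a \<bullet> x = b}"
      then have "\<bar>a \<bullet> x - b\<bar> = \<bar>a \<bullet> (x - z)\<bar>" by (simp add: inner_diff_right)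
      also have "\<dots> \<le> norm a * norm (x - z)" by (rule Cauchy_Schwarz_ineq2)
      finally have "\<bar>a \<bullet> x - b\<bar> / norm a \<le> norm (x - z)"
        using assms by (simp add: field_simps)
      moreover have "dist x p = \<bar>a \<bullet> x - b\<bar> / norm a"
        using assms by (simp add: p_def dist_norm dot_square_norm power2_eq_square)
      ultimately show "dist x p \<le> dist x z" by (simp add: dist_norm)
    qed
  qed
  have "reflect_bdry {x. a \<bullet> x < b} x = 2 *\<^sub>R p - x"
    by (simp add: reflect_bdry_def fr cp)
  also have "\<dots> = x - (2 * (a \<bullet> x - b) / (a \<bullet> a)) *\<^sub>R a"
    by (simp add: p_def scaleR_diff_right scaleR_2)
  finally show ?thesis .
qed

definition polarization :: "'a::euclidean_space set \<Rightarrow> 'a set \<Rightarrow> 'a set" where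
  "polarization H \<Omega> =
     ((\<Omega> \<union> reflect_bdry H ` \<Omega>) \<inter> H) \<union> (\<Omega> \<inter> reflect_bdry H ` \<Omega>)"

definition almost_equal :: "'a::euclidean_space set \<Rightarrow> 'a set \<Rightarrow> bool" (infix "\<cong>\<^sub>m" 50) where
  "A \<cong>\<^sub>m B \<longleftrightarrow> sym_diff A B \<in> null_sets lebesgue"

end

theory Submission
  imports Defs
begin

text \<open>Let \<open>u \<ge> 0\<close> vanish off \<open>\<Omega>\<close> and let \<open>\<sigma>\<close> be the reflection in the boundary of
\<open>H\<close>. Its two-point rearrangement \<open>v\<close> puts the larger of \<open>u x\<close> and \<open>u (\<sigma> x)\<close> on the side of
\<open>H\<close> and the smaller one on the other side; it vanishes off the polarized set and has the same
\<open>L\<^sup>2\<close> norm (\<open>two_point_in_borel_L2\<close>, \<open>two_point_integral_square\<close>). Averaging the energy over the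
four pairs \<open>(x, y)\<close>, \<open>(\<sigma> x, \<sigma> y)\<close>, \<open>(x, \<sigma> y)\<close>, \<open>(\<sigma> x, y)\<close> reduces the comparison of the energies
to a pointwise one. Write \<open>k\<close> and \<open>k'\<close> for the kernel at \<open>x - y\<close> and at \<open>x - \<sigma> y\<close>. As
\<open>v x + v (\<sigma> x) = u x + u (\<sigma> x)\<close>, the integrand increases by \<open>k - k'\<close> times the increase of
\<open>u x * u y + u (\<sigma> x) * u (\<sigma> y)\<close>, and both factors are nonnegative if \<open>x\<close> and \<open>y\<close> lie on the same
side and nonpositive otherwise. So rearrangement does not decrease the energy, which gives the
inequality of the eigenvalues.

For the equality case let \<open>A\<close> be the set of all points of \<open>H\<close> that lie in \<open>\<Omega>\<close> while their mirror
images do not, and let \<open>B\<close> be the set of all points of \<open>H\<close> outside \<open>\<Omega>\<close> whose mirror images lie in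
\<open>\<Omega>\<close>. If \<open>B\<close> is null, polarization changes \<open>\<Omega>\<close> by a null set only; if \<open>A\<close> is null, the polarized
set agrees with the mirror image of \<open>\<Omega>\<close>. If both have positive measure, the eigenvalue increases
strictly: on \<open>A \<times> B\<close> the integrand grows by \<open>(k - k') * u x * u (\<sigma> y)\<close>. An optimal \<open>u\<close>, which is
positive, would conclude the proof at once, but its existence rests on compactness. A bound on the
gain that is uniform over all nearly optimal \<open>u\<close> serves as well, and it is elementary
(\<open>near_maximizer_mass\<close>):

\<^item> The kernel is integrable near the origin, with small integral over small balls, so
  \<open>riesz_form \<beta> u u\<close> is at most \<open>\<epsilon>\<close> times the squared \<open>L\<^sup>2\<close> norm plus a constant times the squared
  \<open>L\<^sup>1\<close> norm. A normalized \<open>u\<close> of energy at least half the eigenvalue thus has an \<open>L\<^sup>1\<close> norm bounded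
  away from \<open>0\<close>.

\<^item> Testing the variational inequality with \<open>u + t * indicator A\<close> for one suitable \<open>t\<close> shows that a
  nearly optimal \<open>u\<close> almost satisfies the eigenvalue equation on \<open>A\<close>. As the kernel is bounded
  below on \<open>\<Omega>\<close>, this bounds the integral of \<open>u\<close> over \<open>A\<close> from below.

Restricting \<open>A\<close> and \<open>B\<close> to points at a positive distance from the hyperplane makes \<open>k - k'\<close>
uniformly positive as well. The energy gain is then at least a fixed positive number, whereas the
energy of \<open>u\<close> is as close to the eigenvalue as desired.\<close>

section \<open>Orthogonal maps preserve Lebesgue measure\<close>

text \<open>Uniqueness of Haar measure in miniature: integrating
\<open>indicator A (f x) * indicator B (y - f x)\<close> over all \<open>x\<close> and \<open>y\<close> in both orders, and using only
translation invariance, gives \<open>\<mu> (f -` A) * \<mu> B = \<mu> A * \<mu> B\<close> for every set \<open>B\<close> with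
\<open>- f x \<in> B \<longleftrightarrow> x \<in> B\<close>; the unit ball is such a set.\<close>

lemma lborel_distr_orthogonal_transformation:
  fixes f :: "'a::euclidean_space \<Rightarrow> 'a"
  assumes f: "orthogonal_transformation f"
  shows "distr lborel borel f = lborel"
proof (rule measure_eqI)
  show "sets (distr lborel borel f) = sets lborel"
    by simp
next
  fix A :: "'a set" assume "A \<in> sets (distr lborel borel f)"
  then have A [measurable]: "A \<in> sets borel" by simp
  have lin: "linear f"
    using f by (rule orthogonal_transformation_linear)
  have [measurable]: "f \<in> borel_measurable borel"
    using lin by (intro borel_measurable_continuous_onI linear_continuous_on)
      (simp add: linear_linear)
  obtain g where g: "\<And>y. f (g y) = y"
    using orthogonal_transformation_surj[OF f] by (metis surjD)
  define B where "B = ball (0::'a) 1"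
  have [measurable]: "B \<in> sets borel"
    by (simp add: B_def)
  have B_inv: "- f x \<in> B \<longleftrightarrow> x \<in> B" for x
    using orthogonal_transformation_norm[OF f] by (simp add: B_def)
  have shift: "(\<integral>\<^sup>+x. h (c + x) \<partial>lborel) = (\<integral>\<^sup>+x. h x \<partial>lborel)"
    if [measurable]: "h \<in> borel_measurable borel" for h :: "'a \<Rightarrow> ennreal" and c
    using nn_integral_distr[of "(+) c" lborel borel h] by (simp add: lborel_distr_plus)
  have mass: "(\<integral>\<^sup>+x. indicator A (f x) \<partial>lborel) = emeasure (distr lborel borel f) A"
    using nn_integral_distr[of f lborel borel "indicator A"] by simp
  have "emeasure (distr lborel borel f) A * emeasure lborel B
      = (\<integral>\<^sup>+x. indicator A (f x) * emeasure lborel B \<partial>lborel)"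
    by (simp add: nn_integral_multc mass)
  also have "\<dots> = (\<integral>\<^sup>+x. (\<integral>\<^sup>+y. indicator A (f x) * indicator B (y - f x) \<partial>lborel) \<partial>lborel)"
  proof (intro nn_integral_cong)
    fix x
    have "(\<integral>\<^sup>+y. indicator A (f x) * indicator B (y - f x) \<partial>lborel)
        = indicator A (f x) * (\<integral>\<^sup>+y. indicator B (- f x + y) \<partial>lborel)"
      by (subst nn_integral_cmult[symmetric]) auto
    also have "(\<integral>\<^sup>+y. indicator B (- f x + y) \<partial>lborel) = emeasure lborel B"
      using shift[of "indicator B" "- f x"] by simp
    finally show "indicator A (f x) * emeasure lborel B
        = (\<integral>\<^sup>+y. indicator A (f x) * indicator B (y - f x) \<partial>lborel)" by simp
  qed
  also have "\<dots> = (\<integral>\<^sup>+y. (\<integral>\<^sup>+x. indicator A (f x) * indicator B (y - f x) \<partial>lborel) \<partial>lborel)"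
    by (rule lborel_pair.Fubini[of "\<lambda>(x, y). indicator A (f x) * indicator B (y - f x)", simplified, symmetric]) measurable
  also have "\<dots> = (\<integral>\<^sup>+y. (\<integral>\<^sup>+x. indicator A (f x + y) * indicator B (- f x) \<partial>lborel) \<partial>lborel)"
  proof (rule nn_integral_cong)
    fix y
    have "(\<integral>\<^sup>+x. indicator A (f x) * indicator B (y - f x) \<partial>lborel)
        = (\<integral>\<^sup>+x. indicator A (f (g y + x)) * indicator B (y - f (g y + x)) \<partial>lborel)"
      by (rule shift[symmetric]) measurable
    then show "(\<integral>\<^sup>+x. indicator A (f x) * indicator B (y - f x) \<partial>lborel)
        = (\<integral>\<^sup>+x. indicator A (f x + y) * indicator B (- f x) \<partial>lborel)"
      by (simp add: linear_add[OF lin] g add.commute)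
  qed
  also have "\<dots> = (\<integral>\<^sup>+x. (\<integral>\<^sup>+y. indicator A (f x + y) * indicator B (- f x) \<partial>lborel) \<partial>lborel)"
    by (rule lborel_pair.Fubini[of "\<lambda>(x, y). indicator A (f x + y) * indicator B (- f x)", simplified]) measurable
  also have "\<dots> = (\<integral>\<^sup>+x. emeasure lborel A * indicator B x \<partial>lborel)"
  proof (intro nn_integral_cong)
    fix x
    have "(\<integral>\<^sup>+y. indicator A (f x + y) * indicator B (- f x) \<partial>lborel)
        = (\<integral>\<^sup>+y. indicator A (f x + y) \<partial>lborel) * indicator B (- f x)"
      by (rule nn_integral_multc) measurable
    also have "(\<integral>\<^sup>+y. indicator A (f x + y) \<partial>lborel) = emeasure lborel A"
      using shift[of "indicator A" "f x"] by simp
    finally show "(\<integral>\<^sup>+y. indicator A (f x + y) * indicator B (- f x) \<partial>lborel)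
        = emeasure lborel A * indicator B x"
      using B_inv by (simp add: indicator_def)
  qed
  also have "\<dots> = emeasure lborel A * emeasure lborel B"
    by (simp add: nn_integral_cmult)
  finally have eq: "emeasure (distr lborel borel f) A * emeasure lborel B
      = emeasure lborel A * emeasure lborel B" .
  have "0 < emeasure lborel B" "emeasure lborel B < \<infinity>"
    unfolding B_def using emeasure_lborel_ball_finite
    by (simp_all add: emeasure_ball del: emeasure_lborel_ball_finite)
  then show "emeasure (distr lborel borel f) A = emeasure lborel A"
    using eq by (metis mult_divide_eq_ennreal less_irrefl infinity_ennreal_def)
qed

section \<open>Local integrability of the Riesz kernel\<close>

text \<open>On the shell where \<open>norm z\<close> lies between \<open>r / 2 ^ Suc j\<close> and \<open>r / 2 ^ j\<close> the kernel is at most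
\<open>(r / 2 ^ Suc j) powr (- \<beta>)\<close>. Replacing each shell by the ball that contains it leaves a geometric
series, which converges as \<open>\<beta>\<close> is less than the dimension.\<close>

lemma nn_integral_ball_inverse_norm_powr_le:
  fixes \<beta> :: real
  assumes \<beta>: "0 < \<beta>" "\<beta> < real DIM('a::euclidean_space)"
  obtains C where "0 \<le> C"
    "\<And>r. 0 < r \<Longrightarrow>
      (\<integral>\<^sup>+z. ennreal (indicator (ball 0 r) z / norm z powr \<beta>) \<partial>(lborel :: 'a measure))
        \<le> ennreal (C * r powr (real DIM('a) - \<beta>))"
proof
  let ?N = "real DIM('a)"
  \<comment> \<open>The series has ratio \<open>q\<close>: halving the radius multiplies the bound for a shell by \<open>q\<close>.\<close>
  define q where "q = (1/2::real) powr (?N - \<beta>)"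
  have q: "0 < q" "q < 1"
    using \<beta> by (auto simp: q_def powr01_less_one)
  define C where "C = unit_ball_vol ?N * 2 powr \<beta> / (1 - q)"
  show "0 \<le> C"
    using q by (simp add: C_def)
  fix r :: real assume r: "0 < r"
  define w where "w j = (r * (1/2) ^ Suc j) powr (- \<beta>)" for j
  have pointwise: "ennreal (indicator (ball 0 r) z / norm z powr \<beta>)
      \<le> (\<Sum>j. ennreal (w j) * indicator (ball 0 (r * (1/2) ^ j)) z)" for z :: 'a
  proof (cases "z = 0 \<or> z \<notin> ball 0 r")
    case False
    then have z: "0 < norm z" "norm z < r" by auto
    define j where "j = (LEAST j. r * (1/2) ^ Suc j \<le> norm z)"
    have "\<exists>j. r * (1/2) ^ Suc j \<le> norm z"
    proof -
      obtain n where "(1/2::real) ^ n < norm z / r"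
        using real_arch_pow_inv[of "norm z / r" "1/2"] z r by auto
      then have "r * (1/2) ^ n < norm z"
        using r by (simp add: field_simps)
      moreover have "r * (1/2) ^ Suc n \<le> r * (1/2) ^ n"
        using r by (intro mult_left_mono power_decreasing) auto
      ultimately show ?thesis by (intro exI[of _ n]) linarith
    qed
    then have lower: "r * (1/2) ^ Suc j \<le> norm z"
      unfolding j_def by (rule LeastI_ex)
    have upper: "norm z < r * (1/2) ^ j"
    proof (cases j)
      case 0
      then show ?thesis using z by simp
    next
      case (Suc i)
      then have "\<not> r * (1/2) ^ Suc i \<le> norm z"
        using not_less_Least[of i "\<lambda>j. r * (1/2) ^ Suc j \<le> norm z"] by (simp add: j_def)
      then show ?thesis using Suc by simp
    qed
    have "1 / norm z powr \<beta> = norm z powr (- \<beta>)"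
      by (simp add: powr_minus_divide)
    also have "\<dots> \<le> w j"
      unfolding w_def using lower r \<beta> by (intro powr_mono2') auto
    finally have "ennreal (indicator (ball 0 r) z / norm z powr \<beta>)
        \<le> ennreal (w j) * indicator (ball 0 (r * (1/2) ^ j)) z"
      using upper z by (simp add: ennreal_leI)
    also have "\<dots> \<le> (\<Sum>j. ennreal (w j) * indicator (ball 0 (r * (1/2) ^ j)) z)"
      using sum_le_suminf[of "\<lambda>j. ennreal (w j) * indicator (ball 0 (r * (1/2) ^ j)) z" "{j}"]
      by (simp del: sum_mult_indicator)
    finally show ?thesis .
  qed auto
  have weight: "w j * (unit_ball_vol ?N * (r * (1/2) ^ j) ^ DIM('a))
      = (unit_ball_vol ?N * 2 powr \<beta> * r powr (?N - \<beta>)) * q ^ j" for j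
  proof -
    have h: "(1/2::real) ^ k = 2 powr (- real k)" for k
      by (simp add: powr_minus powr_realpow power_one_over inverse_eq_divide)
    have "w j = r powr (- \<beta>) * 2 powr (\<beta> * real j + \<beta>)"
      unfolding w_def h using r by (simp add: powr_mult powr_powr algebra_simps)
    moreover have "(r * (1/2) ^ j) ^ DIM('a) = r powr ?N * 2 powr (- real j * ?N)"
      unfolding h using r
      by (simp add: powr_realpow[symmetric] powr_mult powr_powr)
    moreover have "q ^ j = 2 powr (- real j * ?N + real j * \<beta>)"
    proof -
      have "q = 2 powr (- (?N - \<beta>))"
        unfolding q_def powr_minus_divide by (simp add: powr_divide)
      then show ?thesis
        by (simp add: powr_realpow[symmetric] powr_powr algebra_simps)
    qed
    moreover have "r powr (?N - \<beta>) = r powr ?N * r powr (- \<beta>)"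
      by (simp flip: powr_add)
    moreover have "2 powr (\<beta> * real j + \<beta>) = 2 powr \<beta> * 2 powr (real j * \<beta>)"
      by (simp add: ac_simps flip: powr_add)
    moreover have "2 powr (- real j * ?N + real j * \<beta>) = 2 powr (- real j * ?N) * 2 powr (real j * \<beta>)"
      by (rule powr_add)
    ultimately show ?thesis
      by (simp only: ac_simps)
  qed
  have [measurable]: "ball (0::'a) s \<in> sets borel" for s
    by simp
  have "(\<integral>\<^sup>+z. ennreal (indicator (ball 0 r) z / norm z powr \<beta>) \<partial>(lborel :: 'a measure))
      \<le> (\<integral>\<^sup>+z. (\<Sum>j. ennreal (w j) * indicator (ball (0::'a) (r * (1/2) ^ j)) z) \<partial>lborel)"
    by (intro nn_integral_mono pointwise)
  also have "\<dots> = (\<Sum>j. \<integral>\<^sup>+z. ennreal (w j) * indicator (ball (0::'a) (r * (1/2) ^ j)) z \<partial>lborel)"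
    by (intro nn_integral_suminf) measurable
  also have "\<dots> = (\<Sum>j. ennreal (w j) * emeasure lborel (ball (0::'a) (r * (1/2) ^ j)))"
    by (simp add: nn_integral_cmult)
  also have "\<dots> = (\<Sum>j. ennreal ((unit_ball_vol ?N * 2 powr \<beta> * r powr (?N - \<beta>)) * q ^ j))"
    using r by (simp add: emeasure_ball weight[symmetric] ennreal_mult w_def unit_ball_vol_nonneg)
  also have "\<dots> = ennreal ((unit_ball_vol ?N * 2 powr \<beta> * r powr (?N - \<beta>)) * (1 / (1 - q)))"
    using q by (intro suminf_ennreal_eq sums_mult geometric_sums) auto
  finally show "(\<integral>\<^sup>+z. ennreal (indicator (ball 0 r) z / norm z powr \<beta>) \<partial>(lborel :: 'a measure))
        \<le> ennreal (C * r powr (?N - \<beta>))"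
    by (simp add: C_def)
qed

lemma integrable_ball_inverse_norm_powr:
  fixes \<beta> r :: real
  assumes \<beta>: "0 < \<beta>" "\<beta> < real DIM('a::euclidean_space)" and r: "0 < r"
  shows "integrable lborel (\<lambda>z::'a. indicator (ball 0 r) z / norm z powr \<beta>)"
proof -
  obtain C where C: "0 \<le> C"
    "\<And>r. 0 < r \<Longrightarrow>
      (\<integral>\<^sup>+z. ennreal (indicator (ball 0 r) z / norm z powr \<beta>) \<partial>(lborel :: 'a measure))
        \<le> ennreal (C * r powr (real DIM('a) - \<beta>))"
    using nn_integral_ball_inverse_norm_powr_le[OF \<beta>] by blast
  show ?thesis
  proof (rule integrableI_bounded)
    show "(\<lambda>z::'a. indicator (ball 0 r) z / norm z powr \<beta>) \<in> borel_measurable lborel"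
    proof -
      have [measurable]: "ball (0::'a) r \<in> sets borel" by simp
      have [measurable]: "(\<lambda>z::'a. norm z powr \<beta>) \<in> borel_measurable borel" 
        by (intro powr_real_measurable) measurable
      show ?thesis by measurable
    qed
    show "(\<integral>\<^sup>+z. ennreal (norm (indicator (ball 0 r) z / norm z powr \<beta>)) \<partial>(lborel::'a measure)) < \<infinity>"
      using le_less_trans[OF C(2)[OF r]] by simp
  qed
qed

lemma integral_ball_inverse_norm_powr_small:
  fixes \<beta> \<epsilon> :: real
  assumes \<beta>: "0 < \<beta>" "\<beta> < real DIM('a::euclidean_space)" and "0 < \<epsilon>"
  obtains r where "0 < r" "(LINT z|(lborel :: 'a measure). indicator (ball 0 r) z / norm z powr \<beta>) \<le> \<epsilon>"
proof -
  let ?N = "real DIM('a)"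
  obtain C where C: "0 \<le> C"
    "\<And>r. 0 < r \<Longrightarrow>
      (\<integral>\<^sup>+z. ennreal (indicator (ball 0 r) z / norm z powr \<beta>) \<partial>(lborel :: 'a measure))
        \<le> ennreal (C * r powr (?N - \<beta>))"
    using nn_integral_ball_inverse_norm_powr_le[OF \<beta>] by blast
  define r where "r = (\<epsilon> / (C + 1)) powr (1 / (?N - \<beta>))"
  have r: "0 < r"
    using C \<open>0 < \<epsilon>\<close> by (simp add: r_def)
  have "r powr (?N - \<beta>) = \<epsilon> / (C + 1)"
    using \<beta> C \<open>0 < \<epsilon>\<close> by (simp add: r_def powr_powr)
  then have "C * r powr (?N - \<beta>) = C / (C + 1) * \<epsilon>"
    by simp
  also have "\<dots> \<le> 1 * \<epsilon>"
    using C(1) \<open>0 < \<epsilon>\<close> by (intro mult_right_mono) auto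
  finally have "C * r powr (?N - \<beta>) \<le> \<epsilon>"
    by simp
  moreover have "ennreal (LINT z|(lborel :: 'a measure). indicator (ball 0 r) z / norm z powr \<beta>)
      \<le> ennreal (C * r powr (?N - \<beta>))"
    using C(2)[OF r] nn_integral_eq_integral[OF integrable_ball_inverse_norm_powr[OF \<beta> r]] by simp
  ultimately have "(LINT z|(lborel :: 'a measure). indicator (ball 0 r) z / norm z powr \<beta>) \<le> \<epsilon>"
    using C by (simp add: ennreal_le_iff)
  with r that show ?thesis by blast
qed

text \<open>Integrals of the form \<open>\<integral>\<integral> f(x) h(x - y) dx dy\<close> factorize. Evenness of \<open>h\<close> makes the
roles of \<open>x\<close> and \<open>y\<close> interchangeable.\<close>

lemma convolution_integrable:
  fixes f h :: "'a::euclidean_space \<Rightarrow> real"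
  assumes f: "integrable lborel f" and h: "integrable lborel h" and even: "\<And>z. h (- z) = h z"
  shows "integrable (lborel \<Otimes>\<^sub>M lborel) (\<lambda>z. f (fst z) * h (fst z - snd z))" (is ?I1)
    and "integral\<^sup>L (lborel \<Otimes>\<^sub>M lborel) (\<lambda>z. f (fst z) * h (fst z - snd z)) = integral\<^sup>L lborel f * integral\<^sup>L lborel h" (is ?E1)
    and "integrable (lborel \<Otimes>\<^sub>M lborel) (\<lambda>z. f (snd z) * h (fst z - snd z))" (is ?I2)
    and "integral\<^sup>L (lborel \<Otimes>\<^sub>M lborel) (\<lambda>z. f (snd z) * h (fst z - snd z)) = integral\<^sup>L lborel f * integral\<^sup>L lborel h" (is ?E2)
proof -
  note [measurable] = borel_measurable_integrable[OF f] borel_measurable_integrable[OF h]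
  have shift_int: "integrable lborel (\<lambda>y. k (x - y))" "(LINT y|lborel. k (x - y)) = integral\<^sup>L lborel k"
    if k: "integrable lborel k" "\<And>z. k (- z) = k z" for k :: "'a \<Rightarrow> real" and x
  proof -
    have k': "k (x - y) = k (- x + y)" for y
      using k(2)[of "x - y"] by simp
    note [measurable] = borel_measurable_integrable[OF k(1)]
    show "integrable lborel (\<lambda>y. k (x - y))" 
      using integrable_distr_eq[of "(+) (- x)" lborel borel k] k(1)
      unfolding k' by (simp add: lborel_distr_plus)
    show "(LINT y|lborel. k (x - y)) = integral\<^sup>L lborel k"
      using integral_distr[of "(+) (- x)" lborel borel k]
      by (simp add: lborel_distr_plus k')
  qed
  show I1: ?I1
  proof (rule lborel_pair.Fubini_integrable)
    have "integrable lborel (\<lambda>x. \<bar>f x\<bar> * (LINT z|lborel. \<bar>h z\<bar>))"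
      using f by (intro integrable_mult_left) auto
    moreover have "(LINT y|lborel. \<bar>h (x - y)\<bar>) = (LINT z|lborel. \<bar>h z\<bar>)" for x
      by (rule shift_int(2)) (use h even in auto)
    ultimately show "integrable lborel (\<lambda>x. LINT y|lborel. norm (f (fst (x, y)) * h (fst (x, y) - snd (x, y))))"
      by (simp add: abs_mult)
    show "AE x in lborel. integrable lborel (\<lambda>y. f (fst (x, y)) * h (fst (x, y) - snd (x, y)))"
      using shift_int(1)[OF h even] by simp
  qed measurable
  show ?E1
    using lborel_pair.integral_fst'[OF I1] shift_int(2)[OF h even] by simp
  have swap: "(\<lambda>(x, y). f (fst (y, x)) * h (fst (y, x) - snd (y, x))) = (\<lambda>z. f (snd z) * h (fst z - snd z))"
    using even by (auto simp: fun_eq_iff) (metis minus_diff_eq)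
  show ?I2
    using lborel_pair.integrable_product_swap[OF I1] by (simp only: swap)
  have m: "(\<lambda>z. f (fst z) * h (fst z - snd z)) \<in> borel_measurable (lborel \<Otimes>\<^sub>M lborel)"
    by measurable
  show ?E2
    using lborel_pair.integral_product_swap[OF m] \<open>?E1\<close> by (simp only: swap)
qed

section \<open>The Riesz quadratic form on Borel functions\<close>

text \<open>Representatives of \<open>L\<^sup>2(\<Omega>)\<close> that are Borel measurable on the whole space and extended by \<open>0\<close>. For
them, measurability on product spaces and invariance under maps of the whole space come for free.\<close>

definition borel_L2 :: "'a::euclidean_space set \<Rightarrow> ('a \<Rightarrow> real) set" where
  "borel_L2 \<Omega> = {f \<in> borel_measurable borel. (\<forall>x. x \<notin> \<Omega> \<longrightarrow> f x = 0) \<and> integrable lborel (\<lambda>x. (f x)\<^sup>2)}"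

definition riesz_form :: "real \<Rightarrow> ('a::euclidean_space \<Rightarrow> real) \<Rightarrow> ('a \<Rightarrow> real) \<Rightarrow> real" where
  "riesz_form \<beta> f g =
     (LINT z|(lborel \<Otimes>\<^sub>M lborel). f (fst z) * g (snd z) / norm (fst z - snd z) powr \<beta>)"

lemma borel_L2_measurable [measurable_dest]:
  "f \<in> borel_L2 \<Omega> \<Longrightarrow> f \<in> borel_measurable borel"
  by (simp add: borel_L2_def)

lemma borel_L2_zero: "f \<in> borel_L2 \<Omega> \<Longrightarrow> x \<notin> \<Omega> \<Longrightarrow> f x = 0"
  by (simp add: borel_L2_def)

lemma borel_L2_square: "f \<in> borel_L2 \<Omega> \<Longrightarrow> integrable lborel (\<lambda>x. (f x)\<^sup>2)"
  by (simp add: borel_L2_def)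

lemma indicator_in_borel_L2:
  assumes "A \<in> sets borel" "A \<subseteq> \<Omega>" "bounded \<Omega>"
  shows "(indicator A :: 'a::euclidean_space \<Rightarrow> real) \<in> borel_L2 \<Omega>"
proof -
  have "(\<lambda>x. (indicator A x :: real)\<^sup>2) = indicator A"
    by (auto simp: indicator_def)
  moreover have "emeasure lborel A < \<infinity>"
    using assms bounded_subset by (intro emeasure_bounded_finite) blast
  ultimately show ?thesis
    using assms by (auto simp: borel_L2_def indicator_def)
qed

lemma borel_L2_abs: "f \<in> borel_L2 \<Omega> \<Longrightarrow> (\<lambda>x. \<bar>f x\<bar>) \<in> borel_L2 \<Omega>"
  by (auto simp: borel_L2_def intro!: borel_measurable_abs)

lemma borel_L2_cmult: "f \<in> borel_L2 \<Omega> \<Longrightarrow> (\<lambda>x. t * f x) \<in> borel_L2 \<Omega>"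
  by (auto simp: borel_L2_def power_mult_distrib intro!: borel_measurable_times)

lemma borel_L2_mult_integrable:
  assumes f: "f \<in> borel_L2 \<Omega>" and g: "g \<in> borel_L2 \<Omega>"
  shows "integrable lborel (\<lambda>x. f x * g x)"
proof (rule Bochner_Integration.integrable_bound)
  note [measurable] = borel_L2_measurable[OF f] borel_L2_measurable[OF g]
  show "integrable lborel (\<lambda>x. (f x)\<^sup>2 + (g x)\<^sup>2)"
    using f g by (simp add: borel_L2_square)
  show "(\<lambda>x. f x * g x) \<in> borel_measurable lborel"
    by measurable
  show "AE x in lborel. norm (f x * g x) \<le> norm ((f x)\<^sup>2 + (g x)\<^sup>2)"
  proof (intro AE_I2)
    fix x
    have "2 * (\<bar>f x\<bar> * \<bar>g x\<bar>) \<le> (f x)\<^sup>2 + (g x)\<^sup>2"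
      using sum_squares_bound[of "\<bar>f x\<bar>" "\<bar>g x\<bar>"] by simp
    moreover have "0 \<le> \<bar>f x\<bar> * \<bar>g x\<bar>" by simp
    ultimately have "\<bar>f x\<bar> * \<bar>g x\<bar> \<le> (f x)\<^sup>2 + (g x)\<^sup>2" by linarith
    then show "norm (f x * g x) \<le> norm ((f x)\<^sup>2 + (g x)\<^sup>2)"
      by (simp add: abs_mult)
  qed
qed

lemma borel_L2_add:
  assumes f: "f \<in> borel_L2 \<Omega>" and g: "g \<in> borel_L2 \<Omega>"
  shows "(\<lambda>x. f x + t * g x) \<in> borel_L2 \<Omega>"
proof -
  note [measurable] = borel_L2_measurable[OF f] borel_L2_measurable[OF g]
  have "(f x + t * g x)\<^sup>2 = (f x)\<^sup>2 + 2 * t * (f x * g x) + t\<^sup>2 * (g x)\<^sup>2" for x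
    by (simp add: power2_eq_square algebra_simps)
  then have "integrable lborel (\<lambda>x. (f x + t * g x)\<^sup>2)"
    using f g by (simp add: borel_L2_square borel_L2_mult_integrable)
  then show ?thesis
    using f g by (auto simp: borel_L2_def)
qed

lemma integral_square_add:
  assumes f: "f \<in> borel_L2 \<Omega>" and g: "g \<in> borel_L2 \<Omega>"
  shows "(LINT x|lborel. (f x + t * g x)\<^sup>2)
    = (LINT x|lborel. (f x)\<^sup>2) + 2 * t * (LINT x|lborel. f x * g x) + t\<^sup>2 * (LINT x|lborel. (g x)\<^sup>2)"
proof -
  have "(f x + t * g x)\<^sup>2 = (f x)\<^sup>2 + 2 * t * (f x * g x) + t\<^sup>2 * (g x)\<^sup>2" for x
    by (simp add: power2_eq_square algebra_simps)
  then show ?thesis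
    using f g by (simp add: borel_L2_square borel_L2_mult_integrable)
qed

lemma borel_L2_integrable:
  assumes f: "f \<in> borel_L2 \<Omega>" and \<Omega>: "bounded \<Omega>" "\<Omega> \<in> sets borel"
  shows "integrable lborel f"
proof -
  have "integrable lborel (\<lambda>x. f x * indicator \<Omega> x)"
    using f indicator_in_borel_L2[of \<Omega> \<Omega>] \<Omega> by (intro borel_L2_mult_integrable) auto
  moreover have "(\<lambda>x. f x * indicator \<Omega> x) = f"
    using borel_L2_zero[OF f] by (auto simp: indicator_def fun_eq_iff)
  ultimately show ?thesis by simp
qed

lemma integrable_tensor:
  fixes f g :: "'a::euclidean_space \<Rightarrow> real"
  assumes f: "integrable lborel f" and g: "integrable lborel g"
  shows "integrable (lborel \<Otimes>\<^sub>M lborel) (\<lambda>z. f (fst z) * g (snd z))" (is ?I)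
    and "(LINT z|(lborel \<Otimes>\<^sub>M lborel). f (fst z) * g (snd z)) = integral\<^sup>L lborel f * integral\<^sup>L lborel g"
proof -
  note [measurable] = borel_measurable_integrable[OF f] borel_measurable_integrable[OF g]
  show I: ?I
    by (rule lborel_pair.Fubini_integrable) (use f g in \<open>auto simp: abs_mult\<close>)
  show "(LINT z|(lborel \<Otimes>\<^sub>M lborel). f (fst z) * g (snd z)) = integral\<^sup>L lborel f * integral\<^sup>L lborel g"
    using lborel_pair.integral_fst'[OF I] by simp
qed

lemma AE_off_graph:
  fixes T :: "'a::euclidean_space \<Rightarrow> 'a"
  assumes [measurable]: "T \<in> borel_measurable borel"
  shows "AE z in lborel \<Otimes>\<^sub>M lborel. snd z \<noteq> T (fst z)"
proof (rule lborel_pair.AE_pair_measure)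
  show "{z \<in> space (lborel \<Otimes>\<^sub>M lborel). snd z \<noteq> T (fst z)} \<in> sets (lborel \<Otimes>\<^sub>M lborel)"
    by measurable
  show "AE x in lborel. AE y in lborel. snd (x, y) \<noteq> T (fst (x, y))"
    by (simp add: AE_lborel_singleton)
qed

text \<open>Below distance \<open>r\<close> the product is split by the arithmetic-geometric mean inequality; beyond it the
kernel is bounded. The near part will be controlled by the \<open>L\<^sup>2\<close> norm with a constant that is small
with \<open>r\<close>, the far part by the \<open>L\<^sup>1\<close> norm.\<close>

lemma riesz_kernel_split:
  fixes p q d r \<beta> :: real
  assumes "0 < r" "0 < \<beta>" "0 \<le> d"
  shows "\<bar>p * q\<bar> / d powr \<beta>
    \<le> (p\<^sup>2 + q\<^sup>2) / 2 * (indicator {..<r} d / d powr \<beta>) + r powr (- \<beta>) * (\<bar>p\<bar> * \<bar>q\<bar>)"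
proof (cases "d < r")
  case True
  have "\<bar>p * q\<bar> \<le> (p\<^sup>2 + q\<^sup>2) / 2"
    using sum_squares_bound[of "\<bar>p\<bar>" "\<bar>q\<bar>"] by (simp add: abs_mult)
  then have "\<bar>p * q\<bar> / d powr \<beta> \<le> (p\<^sup>2 + q\<^sup>2) / 2 / d powr \<beta>"
    by (rule divide_right_mono) simp
  also have "\<dots> \<le> (p\<^sup>2 + q\<^sup>2) / 2 / d powr \<beta> + r powr (- \<beta>) * (\<bar>p\<bar> * \<bar>q\<bar>)"
    by simp
  finally show ?thesis
    using True by simp
next
  case False
  then have "d powr (- \<beta>) \<le> r powr (- \<beta>)"
    using assms by (intro powr_mono2') auto
  then have "(\<bar>p\<bar> * \<bar>q\<bar>) * d powr (- \<beta>) \<le> (\<bar>p\<bar> * \<bar>q\<bar>) * r powr (- \<beta>)"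
    by (rule mult_left_mono) simp
  then show ?thesis
    using False by (simp add: powr_minus_divide abs_mult mult.commute)
qed

lemma riesz_form_sym:
  assumes [measurable]: "f \<in> borel_measurable borel" "g \<in> borel_measurable borel"
  shows "riesz_form \<beta> g f = riesz_form \<beta> f g"
proof -
  have m: "(\<lambda>z. f (fst z) * g (snd z) / norm (fst z - snd z) powr \<beta>)
      \<in> borel_measurable (lborel \<Otimes>\<^sub>M lborel)"
    by measurable
  show ?thesis
    using lborel_pair.integral_product_swap[OF m]
    by (simp add: riesz_form_def split_beta' norm_minus_commute mult.commute)
qed

context
  fixes \<beta> :: real and \<Omega> :: "'a::euclidean_space set"
  assumes \<beta>: "0 < \<beta>" "\<beta> < real DIM('a)" and \<Omega>: "bounded \<Omega>" "\<Omega> \<in> sets borel"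
begin

lemma riesz_majorant:
  assumes f: "f \<in> borel_L2 \<Omega>" and g: "g \<in> borel_L2 \<Omega>" and r: "0 < r"
  shows "integrable (lborel \<Otimes>\<^sub>M lborel) (\<lambda>z. ((f (fst z))\<^sup>2 + (g (snd z))\<^sup>2) / 2 *
            (indicator {..<r} (norm (fst z - snd z)) / norm (fst z - snd z) powr \<beta>)
            + r powr (- \<beta>) * (\<bar>f (fst z)\<bar> * \<bar>g (snd z)\<bar>))" (is "integrable _ ?M")
    and "integral\<^sup>L (lborel \<Otimes>\<^sub>M lborel) (\<lambda>z. ((f (fst z))\<^sup>2 + (g (snd z))\<^sup>2) / 2 *
            (indicator {..<r} (norm (fst z - snd z)) / norm (fst z - snd z) powr \<beta>)
            + r powr (- \<beta>) * (\<bar>f (fst z)\<bar> * \<bar>g (snd z)\<bar>))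
      = ((LINT x|lborel. (f x)\<^sup>2) + (LINT x|lborel. (g x)\<^sup>2)) / 2
          * (LINT z|(lborel :: 'a measure). indicator (ball 0 r) z / norm z powr \<beta>)
        + r powr (- \<beta>) * ((LINT x|lborel. \<bar>f x\<bar>) * (LINT x|lborel. \<bar>g x\<bar>))"
proof -
  define h where "h z = indicator (ball 0 r) z / norm z powr \<beta>" for z :: 'a
  have h: "integrable lborel h" "\<And>z. h (- z) = h z"
    using integrable_ball_inverse_norm_powr[OF \<beta> r] by (auto simp: h_def[abs_def] indicator_def)
  note conv_f = convolution_integrable(1,2)[OF borel_L2_square[OF f] h]
  note conv_g = convolution_integrable(3,4)[OF borel_L2_square[OF g] h]
  note tensor = integrable_tensor[OF integrable_abs integrable_abs,
      OF borel_L2_integrable[OF f \<Omega>] borel_L2_integrable[OF g \<Omega>]]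
  have M: "?M = (\<lambda>z. ((f (fst z))\<^sup>2 * h (fst z - snd z) + (g (snd z))\<^sup>2 * h (fst z - snd z)) / 2
      + r powr (- \<beta>) * (\<bar>f (fst z)\<bar> * \<bar>g (snd z)\<bar>))"
    by (simp add: h_def indicator_def fun_eq_iff add_divide_distrib distrib_right)
  show "integrable (lborel \<Otimes>\<^sub>M lborel) ?M"
    unfolding M using conv_f(1) conv_g(1) tensor(1) by simp
  show "integral\<^sup>L (lborel \<Otimes>\<^sub>M lborel) ?M
      = ((LINT x|lborel. (f x)\<^sup>2) + (LINT x|lborel. (g x)\<^sup>2)) / 2
          * (LINT z|(lborel :: 'a measure). indicator (ball 0 r) z / norm z powr \<beta>)
        + r powr (- \<beta>) * ((LINT x|lborel. \<bar>f x\<bar>) * (LINT x|lborel. \<bar>g x\<bar>))"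
    unfolding M using conv_f conv_g tensor
    by (simp add: h_def[abs_def, symmetric] distrib_right add_divide_distrib)
qed

lemma riesz_form_integrable:
  assumes f: "f \<in> borel_L2 \<Omega>" and g: "g \<in> borel_L2 \<Omega>"
  shows "integrable (lborel \<Otimes>\<^sub>M lborel)
    (\<lambda>z. f (fst z) * g (snd z) / norm (fst z - snd z) powr \<beta>)"
proof (rule Bochner_Integration.integrable_bound[OF riesz_majorant(1)[OF f g zero_less_one]])
  note [measurable] = borel_L2_measurable[OF f] borel_L2_measurable[OF g]
  show "(\<lambda>z. f (fst z) * g (snd z) / norm (fst z - snd z) powr \<beta>)
      \<in> borel_measurable (lborel \<Otimes>\<^sub>M lborel)"
    by measurable
  show "AE z in lborel \<Otimes>\<^sub>M lborel. norm (f (fst z) * g (snd z) / norm (fst z - snd z) powr \<beta>)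
      \<le> norm (((f (fst z))\<^sup>2 + (g (snd z))\<^sup>2) / 2 *
            (indicator {..<1} (norm (fst z - snd z)) / norm (fst z - snd z) powr \<beta>)
            + 1 powr (- \<beta>) * (\<bar>f (fst z)\<bar> * \<bar>g (snd z)\<bar>))"
    using riesz_kernel_split[OF zero_less_one \<beta>(1)] by (intro AE_I2) (force simp: abs_mult)
qed

lemma riesz_form_le:
  assumes f: "f \<in> borel_L2 \<Omega>" and r: "0 < r"
  shows "riesz_form \<beta> f f \<le> (LINT z|(lborel :: 'a measure). indicator (ball 0 r) z / norm z powr \<beta>)
      * (LINT x|lborel. (f x)\<^sup>2) + r powr (- \<beta>) * (LINT x|lborel. \<bar>f x\<bar>)\<^sup>2"
proof -
  have "riesz_form \<beta> f f \<le> integral\<^sup>L (lborel \<Otimes>\<^sub>M lborel) (\<lambda>z. ((f (fst z))\<^sup>2 + (f (snd z))\<^sup>2) / 2 *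
            (indicator {..<r} (norm (fst z - snd z)) / norm (fst z - snd z) powr \<beta>)
            + r powr (- \<beta>) * (\<bar>f (fst z)\<bar> * \<bar>f (snd z)\<bar>))"
    unfolding riesz_form_def
  proof (rule integral_mono[OF riesz_form_integrable[OF f f] riesz_majorant(1)[OF f f r]])
    fix z :: "'a \<times> 'a"
    have "f (fst z) * f (snd z) / norm (fst z - snd z) powr \<beta>
        \<le> \<bar>f (fst z) * f (snd z)\<bar> / norm (fst z - snd z) powr \<beta>"
      by (intro divide_right_mono) auto
    with riesz_kernel_split[OF r \<beta>(1), of "norm (fst z - snd z)" "f (fst z)" "f (snd z)"]
    show "f (fst z) * f (snd z) / norm (fst z - snd z) powr \<beta> \<le> ((f (fst z))\<^sup>2 + (f (snd z))\<^sup>2) / 2 *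
            (indicator {..<r} (norm (fst z - snd z)) / norm (fst z - snd z) powr \<beta>)
            + r powr (- \<beta>) * (\<bar>f (fst z)\<bar> * \<bar>f (snd z)\<bar>)"
      by simp
  qed
  then show ?thesis
    unfolding riesz_majorant(2)[OF f f r] by (simp add: power2_eq_square mult.commute)
qed

text \<open>On a set of diameter at most \<open>D\<close> the kernel is at least \<open>D powr (- \<beta>)\<close> off the diagonal. On the
diagonal it has the default value \<open>0\<close>, so that the bound holds only almost everywhere.\<close>

lemma riesz_form_ge:
  assumes f: "f \<in> borel_L2 \<Omega>" "\<And>x. 0 \<le> f x" and g: "g \<in> borel_L2 \<Omega>" "\<And>x. 0 \<le> g x"
    and D: "\<And>x y. x \<in> \<Omega> \<Longrightarrow> y \<in> \<Omega> \<Longrightarrow> norm (x - y) \<le> D"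
  shows "D powr (- \<beta>) * (integral\<^sup>L lborel f * integral\<^sup>L lborel g) \<le> riesz_form \<beta> f g"
proof -
  note tensor = integrable_tensor[OF borel_L2_integrable[OF f(1) \<Omega>] borel_L2_integrable[OF g(1) \<Omega>]]
  have "(LINT z|(lborel \<Otimes>\<^sub>M lborel). D powr (- \<beta>) * (f (fst z) * g (snd z))) \<le> riesz_form \<beta> f g"
    unfolding riesz_form_def
  proof (rule integral_mono_AE[OF _ riesz_form_integrable[OF f(1) g(1)]])
    show "integrable (lborel \<Otimes>\<^sub>M lborel) (\<lambda>z. D powr (- \<beta>) * (f (fst z) * g (snd z)))"
      using tensor(1) by simp
    have "AE z in lborel \<Otimes>\<^sub>M lborel. snd z \<noteq> fst (z :: 'a \<times> 'a)"
      using AE_off_graph[of "\<lambda>x::'a. x"] by simp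
    then show "AE z in lborel \<Otimes>\<^sub>M lborel. D powr (- \<beta>) * (f (fst z) * g (snd z))
        \<le> f (fst z) * g (snd z) / norm (fst z - snd z) powr \<beta>"
    proof eventually_elim
      case (elim z)
      show ?case
      proof (cases "fst z \<in> \<Omega> \<and> snd z \<in> \<Omega>")
        case True
        then have "D powr (- \<beta>) \<le> norm (fst z - snd z) powr (- \<beta>)"
          using elim \<beta> D by (intro powr_mono2') auto
        then have "(f (fst z) * g (snd z)) * D powr (- \<beta>)
            \<le> (f (fst z) * g (snd z)) * norm (fst z - snd z) powr (- \<beta>)"
          using f(2) g(2) by (intro mult_left_mono) auto
        then show ?thesis
          by (simp add: powr_minus_divide mult.commute)
      next
        case False
        then show ?thesis
          using borel_L2_zero[OF f(1)] borel_L2_zero[OF g(1)] by auto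
      qed
    qed
  qed
  then show ?thesis
    using tensor(2) by simp
qed

lemma riesz_form_add:
  assumes f: "f \<in> borel_L2 \<Omega>" and g: "g \<in> borel_L2 \<Omega>"
  shows "riesz_form \<beta> (\<lambda>x. f x + t * g x) (\<lambda>x. f x + t * g x)
    = riesz_form \<beta> f f + 2 * t * riesz_form \<beta> f g + t\<^sup>2 * riesz_form \<beta> g g"
proof -
  let ?k = "\<lambda>z. norm (fst z - snd z :: 'a) powr \<beta>"
  have "riesz_form \<beta> (\<lambda>x. f x + t * g x) (\<lambda>x. f x + t * g x)
      = (LINT z|(lborel \<Otimes>\<^sub>M lborel). f (fst z) * f (snd z) / ?k z + t * (f (fst z) * g (snd z) / ?k z)
          + t * (g (fst z) * f (snd z) / ?k z) + t\<^sup>2 * (g (fst z) * g (snd z) / ?k z))"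
    unfolding riesz_form_def
    by (intro Bochner_Integration.integral_cong)
      (auto simp: power2_eq_square algebra_simps add_divide_distrib)
  also have "\<dots> = riesz_form \<beta> f f + t * riesz_form \<beta> f g + t * riesz_form \<beta> g f + t\<^sup>2 * riesz_form \<beta> g g"
    using riesz_form_integrable f g by (simp add: riesz_form_def del: times_divide_eq_right)
  finally show ?thesis
    by (simp add: riesz_form_sym[OF borel_L2_measurable[OF f] borel_L2_measurable[OF g]])
qed

lemma riesz_form_le_abs:
  assumes f: "f \<in> borel_L2 \<Omega>"
  shows "riesz_form \<beta> f f \<le> riesz_form \<beta> (\<lambda>x. \<bar>f x\<bar>) (\<lambda>x. \<bar>f x\<bar>)"
  unfolding riesz_form_def
proof (rule integral_mono[OF riesz_form_integrable[OF f f]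
      riesz_form_integrable[OF borel_L2_abs[OF f] borel_L2_abs[OF f]]])
  fix z
  have "f (fst z) * f (snd z) \<le> \<bar>f (fst z)\<bar> * \<bar>f (snd z)\<bar>"
    by (metis abs_ge_self abs_mult)
  then show "f (fst z) * f (snd z) / norm (fst z - snd z) powr \<beta>
      \<le> \<bar>f (fst z)\<bar> * \<bar>f (snd z)\<bar> / norm (fst z - snd z) powr \<beta>"
    by (rule divide_right_mono) simp
qed

end

section \<open>Passing from the eigenvalue to Borel functions\<close>

text \<open>The inner integral is a factor \<open>u y\<close> times a potential, and the potential does not change when \<open>u\<close>
is replaced by \<open>f\<close>. Factoring first keeps the outer integrand measurable although \<open>u\<close> is only
Lebesgue measurable.\<close>

lemma lebesgue_on_representative:
  fixes u f :: "'a::euclidean_space \<Rightarrow> real"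
  assumes \<Omega>: "\<Omega> \<in> sets borel" and u: "u \<in> borel_measurable (lebesgue_on \<Omega>)"
    and f: "f \<in> borel_measurable borel" "\<And>x. x \<notin> \<Omega> \<Longrightarrow> f x = 0"
    and eq: "AE x in lebesgue_on \<Omega>. u x = f x"
  shows "integrable (lebesgue_on \<Omega>) (\<lambda>x. (u x)\<^sup>2) \<longleftrightarrow> integrable lborel (\<lambda>x. (f x)\<^sup>2)"
    and "(LINT x|lebesgue_on \<Omega>. (u x)\<^sup>2) = (LINT x|lborel. (f x)\<^sup>2)"
    and "riesz_energy \<alpha> \<Omega> u
      = (LINT y|lborel. LINT x|lborel. f x * f y / norm (x - y) powr (real DIM('a) - \<alpha>))"
proof -
  note [measurable] = u f(1)
  have \<Omega>': "\<Omega> \<inter> space lebesgue \<in> sets lebesgue"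
    using \<Omega> by simp
  have borel_leb: "h \<in> borel_measurable (lebesgue_on \<Omega>)" if "h \<in> borel_measurable borel" for h :: "'a \<Rightarrow> real"
    using that by (intro measurable_restrict_space1 measurable_completion) simp
  have restrict: "integrable (lebesgue_on \<Omega>) h \<longleftrightarrow> integrable lborel h"
      "integral\<^sup>L (lebesgue_on \<Omega>) h = integral\<^sup>L lborel h"
    if h: "h \<in> borel_measurable borel" "\<And>x. x \<notin> \<Omega> \<Longrightarrow> h x = 0" for h :: "'a \<Rightarrow> real"
  proof -
    have "(\<lambda>x. indicator \<Omega> x *\<^sub>R h x) = h"
      using h(2) by (auto simp: indicator_def fun_eq_iff)
    moreover have "h \<in> borel_measurable lborel"
      using h(1) by simp
    ultimately show "integrable (lebesgue_on \<Omega>) h \<longleftrightarrow> integrable lborel h"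
      "integral\<^sup>L (lebesgue_on \<Omega>) h = integral\<^sup>L lborel h"
      using integrable_restrict_space[OF \<Omega>', of h] integral_restrict_space[OF \<Omega>', of h]
        integrable_completion[of h lborel] integral_completion[of h lborel] by simp_all
  qed
  have f_leb [measurable]: "f \<in> borel_measurable (lebesgue_on \<Omega>)"
    using f(1) by (rule borel_leb)
  have sq_eq: "AE x in lebesgue_on \<Omega>. (u x)\<^sup>2 = (f x)\<^sup>2"
    using eq by eventually_elim simp
  have "integrable (lebesgue_on \<Omega>) (\<lambda>x. (u x)\<^sup>2) \<longleftrightarrow> integrable (lebesgue_on \<Omega>) (\<lambda>x. (f x)\<^sup>2)"
    using sq_eq by (intro integrable_cong_AE) measurable
  also have "\<dots> \<longleftrightarrow> integrable lborel (\<lambda>x. (f x)\<^sup>2)"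
    by (rule restrict) (use f in auto)
  finally show "integrable (lebesgue_on \<Omega>) (\<lambda>x. (u x)\<^sup>2) \<longleftrightarrow> integrable lborel (\<lambda>x. (f x)\<^sup>2)" .
  have "(LINT x|lebesgue_on \<Omega>. (u x)\<^sup>2) = (LINT x|lebesgue_on \<Omega>. (f x)\<^sup>2)"
    using sq_eq by (intro integral_cong_AE) measurable
  also have "\<dots> = (LINT x|lborel. (f x)\<^sup>2)"
    by (rule restrict) (use f in auto)
  finally show "(LINT x|lebesgue_on \<Omega>. (u x)\<^sup>2) = (LINT x|lborel. (f x)\<^sup>2)" .
  define \<beta> where "\<beta> = real DIM('a) - \<alpha>"
  define G where "G y = (LINT x|lborel. f x / norm (x - y) powr \<beta>)" for y
  have G [measurable]: "G \<in> borel_measurable borel"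
    unfolding G_def[abs_def] by measurable
  note G_leb [measurable] = borel_leb[OF G]
  have inner: "(LINT x|lebesgue_on \<Omega>. u x * c / norm (x - y) powr \<beta>) = c * G y" for c y
  proof -
    have k [measurable]: "(\<lambda>x. norm (x - y) powr \<beta>) \<in> borel_measurable (lebesgue_on \<Omega>)"
      by (rule borel_leb) measurable
    have "(LINT x|lebesgue_on \<Omega>. u x * c / norm (x - y) powr \<beta>)
        = (LINT x|lebesgue_on \<Omega>. c * (f x / norm (x - y) powr \<beta>))"
    proof (rule integral_cong_AE)
      show "AE x in lebesgue_on \<Omega>. u x * c / norm (x - y) powr \<beta> = c * (f x / norm (x - y) powr \<beta>)"
        using eq by eventually_elim simp
    qed measurable
    also have "\<dots> = (LINT x|lborel. c * (f x / norm (x - y) powr \<beta>))"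
      by (rule restrict) (use f in auto)
    finally show ?thesis
      by (simp add: G_def del: times_divide_eq_right)
  qed
  have "riesz_energy \<alpha> \<Omega> u = (LINT y|lebesgue_on \<Omega>. u y * G y)"
    unfolding riesz_energy_def \<beta>_def[symmetric] inner ..
  also have "\<dots> = (LINT y|lebesgue_on \<Omega>. f y * G y)"
  proof (rule integral_cong_AE)
    show "AE y in lebesgue_on \<Omega>. u y * G y = f y * G y"
      using eq by eventually_elim simp
  qed measurable
  also have "\<dots> = (LINT y|lborel. f y * G y)"
    by (rule restrict) (use f in auto)
  also have "\<dots> = (LINT y|lborel. LINT x|lborel. f y * (f x / norm (x - y) powr \<beta>))"
    by (simp add: G_def del: times_divide_eq_right)
  finally show "riesz_energy \<alpha> \<Omega> u
      = (LINT y|lborel. LINT x|lborel. f x * f y / norm (x - y) powr (real DIM('a) - \<alpha>))"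
    by (simp add: \<beta>_def mult.commute)
qed

lemma ex_borel_representative:
  fixes u :: "'a::euclidean_space \<Rightarrow> real"
  assumes \<Omega>: "\<Omega> \<in> sets borel" and u: "u \<in> borel_measurable (lebesgue_on \<Omega>)"
  obtains f where "f \<in> borel_measurable borel" "\<And>x. x \<notin> \<Omega> \<Longrightarrow> f x = 0"
    "AE x in lebesgue_on \<Omega>. u x = f x"
proof -
  have \<Omega>': "\<Omega> \<in> sets lebesgue"
    using \<Omega> by simp
  have "(\<lambda>x. if x \<in> \<Omega> then u x else 0) \<in> borel_measurable lebesgue"
    using u \<Omega>' by (rule borel_measurable_if_I)
  then obtain g where g [measurable]: "g \<in> borel_measurable borel"
      and eq: "AE x in lborel. (if x \<in> \<Omega> then u x else 0) = g x"
    using completion_ex_borel_measurable_real by force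
  show ?thesis
  proof (rule that[of "\<lambda>x. indicator \<Omega> x * g x"])
    show "(\<lambda>x. indicator \<Omega> x * g x) \<in> borel_measurable borel"
      using \<Omega> by measurable
    have "AE x in lebesgue. (if x \<in> \<Omega> then u x else 0) = g x"
      using eq by (rule AE_completion)
    then have "AE x in lebesgue. x \<in> \<Omega> \<longrightarrow> u x = indicator \<Omega> x * g x"
      by eventually_elim auto
    then show "AE x in lebesgue_on \<Omega>. u x = indicator \<Omega> x * g x"
      using \<Omega>' by (simp add: AE_restrict_space_iff)
  qed simp
qed

section \<open>Nearly optimal functions\<close>

lemma integral_abs_le:
  assumes f: "f \<in> borel_L2 \<Omega>" and \<Omega>: "bounded \<Omega>" "\<Omega> \<in> sets borel"
  shows "(LINT x|lborel. \<bar>f x\<bar>) \<le> (measure lborel \<Omega> + (LINT x|lborel. (f x)\<^sup>2)) / 2"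
proof -
  have ind: "integrable lborel (indicator \<Omega> :: 'a \<Rightarrow> real)"
    using \<Omega>(2) emeasure_bounded_finite[OF \<Omega>(1)] by simp
  have "(LINT x|lborel. \<bar>f x\<bar>) \<le> (LINT x|lborel. (indicator \<Omega> x + (f x)\<^sup>2) / 2)"
  proof (rule integral_mono)
    show "integrable lborel (\<lambda>x. \<bar>f x\<bar>)"
      using borel_L2_integrable[OF f \<Omega>(1) \<Omega>(2)] by simp
    show "integrable lborel (\<lambda>x. (indicator \<Omega> x + (f x)\<^sup>2) / 2)"
      using ind borel_L2_square[OF f] by simp
    show "\<bar>f x\<bar> \<le> (indicator \<Omega> x + (f x)\<^sup>2) / 2" for x
      using sum_squares_bound[of 1 "\<bar>f x\<bar>"] borel_L2_zero[OF f, of x] by (cases "x \<in> \<Omega>") auto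
  qed
  also have "\<dots> = (measure lborel \<Omega> + (LINT x|lborel. (f x)\<^sup>2)) / 2"
    using ind borel_L2_square[OF f] \<Omega>(2) by simp
  finally show ?thesis .
qed

lemma measure_open_pos:
  fixes \<Omega> :: "'a::euclidean_space set"
  assumes \<Omega>: "bounded \<Omega>" "open \<Omega>" and "\<Omega> \<noteq> {}"
  shows "0 < measure lborel \<Omega>"
proof -
  obtain x e where "0 < e" "ball x e \<subseteq> \<Omega>"
    using \<Omega>(2) \<open>\<Omega> \<noteq> {}\<close> open_contains_ball by blast
  from this(2) have "measure lborel (ball x e) \<le> measure lborel \<Omega>"
    using \<Omega>(2) emeasure_bounded_finite[OF \<Omega>(1)]
    by (intro measure_mono_fmeasurable) (auto simp: fmeasurable_def)
  moreover have "0 < measure lborel (ball x e)"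
    using \<open>0 < e\<close> content_ball_pos by blast
  ultimately show ?thesis by linarith
qed

lemma bounded_norm_diff_le:
  assumes "bounded \<Omega>"
  obtains D where "0 < D" "\<And>x y. x \<in> \<Omega> \<Longrightarrow> y \<in> \<Omega> \<Longrightarrow> norm (x - y) \<le> D"
proof -
  obtain M where M: "0 < M" "\<And>x. x \<in> \<Omega> \<Longrightarrow> norm x \<le> M"
    using assms bounded_pos by metis
  show thesis
  proof (rule that[of "2 * M"])
    show "norm (x - y) \<le> 2 * M" if "x \<in> \<Omega>" "y \<in> \<Omega>" for x y
      using norm_triangle_ineq4[of x y] M(2)[OF that(1)] M(2)[OF that(2)] by linarith
  qed (use M in simp)
qed

lemma indicator_integrals:
  fixes A :: "'a::euclidean_space set"
  assumes "A \<in> sets borel"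
  shows "(LINT x|lborel. indicator A x) = measure lborel A"
    and "(LINT x|lborel. (indicator A x)\<^sup>2) = measure lborel A"
proof -
  have "(indicator A x :: real)\<^sup>2 = indicator A x" for x
    by (simp add: indicator_def)
  then show "(LINT x|lborel. indicator A x) = measure lborel A"
    and "(LINT x|lborel. (indicator A x)\<^sup>2) = measure lborel A"
    using assms by simp_all
qed

context
  fixes \<alpha> \<beta> :: real and \<Omega> :: "'a::euclidean_space set"
  assumes \<alpha>: "0 < \<alpha>" "\<alpha> < real DIM('a)" and \<beta>: "\<beta> = real DIM('a) - \<alpha>" and \<Omega>: "bounded \<Omega>" "open \<Omega>"
begin

lemma kernel_exponent_bounds: "0 < \<beta>" "\<beta> < real DIM('a)" and domain_borel: "\<Omega> \<in> sets borel"
  using \<alpha> \<beta> \<Omega> by auto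

lemma riesz_lambda1_borel:
  "riesz_lambda1 \<alpha> \<Omega>
    = Sup {riesz_form \<beta> f f | f. f \<in> borel_L2 \<Omega> \<and> (LINT x|lborel. (f x)\<^sup>2) = 1}"
proof -
  have iterated: "(LINT y|lborel. LINT x|lborel. f x * f y / norm (x - y) powr \<beta>) = riesz_form \<beta> f f"
    if "f \<in> borel_L2 \<Omega>" for f
    using riesz_form_integrable[OF kernel_exponent_bounds \<Omega>(1) domain_borel that that]
      lborel_pair.integral_snd[of "\<lambda>x y. f x * f y / norm (x - y) powr \<beta>"]
    by (simp add: riesz_form_def split_beta')
  have "\<exists>f. f \<in> borel_L2 \<Omega> \<and> (LINT x|lborel. (f x)\<^sup>2) = 1 \<and> riesz_energy \<alpha> \<Omega> u = riesz_form \<beta> f f"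
    if u: "u square_integrable_on \<Omega>" "L2norm_on \<Omega> u = 1" for u
  proof -
    have um: "u \<in> borel_measurable (lebesgue_on \<Omega>)"
      and ui: "integrable (lebesgue_on \<Omega>) (\<lambda>x. (u x)\<^sup>2)"
      using u(1) by (auto simp: square_integrable_on_def)
    have un: "(LINT x|lebesgue_on \<Omega>. (u x)\<^sup>2) = 1"
      using u(2) by (simp add: L2norm_on_def)
    obtain f where f: "f \<in> borel_measurable borel" "\<And>x. x \<notin> \<Omega> \<Longrightarrow> f x = 0"
        "AE x in lebesgue_on \<Omega>. u x = f x"
      using ex_borel_representative[OF domain_borel um] by blast
    note rep = lebesgue_on_representative[OF domain_borel um f]
    have L2: "f \<in> borel_L2 \<Omega>"
      using f(1,2) rep(1) ui by (simp add: borel_L2_def)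
    then show ?thesis
      using rep(2) rep(3)[of \<alpha>, folded \<beta>] un iterated[OF L2] by auto
  qed
  moreover have "\<exists>u. u square_integrable_on \<Omega> \<and> L2norm_on \<Omega> u = 1 \<and> riesz_energy \<alpha> \<Omega> u = riesz_form \<beta> f f"
    if f: "f \<in> borel_L2 \<Omega>" "(LINT x|lborel. (f x)\<^sup>2) = 1" for f
  proof -
    have fm: "f \<in> borel_measurable (lebesgue_on \<Omega>)"
      using borel_L2_measurable[OF f(1)] by (intro measurable_restrict_space1 measurable_completion) simp
    note rep = lebesgue_on_representative[OF domain_borel fm borel_L2_measurable[OF f(1)] borel_L2_zero[OF f(1)]]
    show ?thesis
      using rep(1,2) rep(3)[of \<alpha>, folded \<beta>] fm f borel_L2_square[OF f(1)] iterated[OF f(1)]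
      by (intro exI[of _ f]) (auto simp: square_integrable_on_def L2norm_on_def)
  qed
  ultimately have "{riesz_energy \<alpha> \<Omega> u | u. u square_integrable_on \<Omega> \<and> L2norm_on \<Omega> u = 1}
      = {riesz_form \<beta> f f | f. f \<in> borel_L2 \<Omega> \<and> (LINT x|lborel. (f x)\<^sup>2) = 1}"
    by (intro set_eqI) (simp, metis)
  then show ?thesis
    by (simp add: riesz_lambda1_def)
qed

lemma bdd_above_riesz_form:
  "bdd_above {riesz_form \<beta> f f | f. f \<in> borel_L2 \<Omega> \<and> (LINT x|lborel. (f x)\<^sup>2) = 1}"
proof (rule bdd_aboveI)
  fix e assume "e \<in> {riesz_form \<beta> f f | f. f \<in> borel_L2 \<Omega> \<and> (LINT x|lborel. (f x)\<^sup>2) = 1}"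
  then obtain f where f: "f \<in> borel_L2 \<Omega>" "(LINT x|lborel. (f x)\<^sup>2) = 1" "e = riesz_form \<beta> f f"
    by auto
  have "(LINT x|lborel. \<bar>f x\<bar>)\<^sup>2 \<le> ((measure lborel \<Omega> + 1) / 2)\<^sup>2"
    using integral_abs_le[OF f(1) \<Omega>(1) domain_borel] f(2) by (intro power_mono) auto
  moreover have "e \<le> (LINT z|(lborel :: 'a measure). indicator (ball 0 1) z / norm z powr \<beta>)
      + (LINT x|lborel. \<bar>f x\<bar>)\<^sup>2"
    using riesz_form_le[OF kernel_exponent_bounds \<Omega>(1) domain_borel f(1) zero_less_one] f(2,3) by simp
  ultimately show "e \<le> (LINT z|(lborel :: 'a measure). indicator (ball 0 1) z / norm z powr \<beta>)
      + ((measure lborel \<Omega> + 1) / 2)\<^sup>2"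
    by linarith
qed

text \<open>By homogeneity the supremum over normalized functions bounds the form everywhere. Functions of norm
\<open>0\<close> cannot be normalized; their energy vanishes since they are zero almost everywhere.\<close>

lemma riesz_form_le_lambda1:
  assumes f: "f \<in> borel_L2 \<Omega>"
  shows "riesz_form \<beta> f f \<le> riesz_lambda1 \<alpha> \<Omega> * (LINT x|lborel. (f x)\<^sup>2)"
proof (cases "(LINT x|lborel. (f x)\<^sup>2) = 0")
  case True
  then have "AE x in lborel. (f x)\<^sup>2 = 0"
    using integral_nonneg_eq_0_iff_AE[OF borel_L2_square[OF f]] by simp
  then have "(LINT x|lborel. \<bar>f x\<bar>) = 0"
    by (intro integral_eq_zero_AE) auto
  then show ?thesis
    using riesz_form_le[OF kernel_exponent_bounds \<Omega>(1) domain_borel f zero_less_one] True by simp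
next
  case False
  define s where "s = (LINT x|lborel. (f x)\<^sup>2)"
  have "0 \<le> s"
    by (simp add: s_def)
  moreover have "s \<noteq> 0"
    using False by (simp add: s_def)
  ultimately have s: "0 < s"
    by linarith
  define g where "g x = 1 / sqrt s * f x" for x
  have g: "g \<in> borel_L2 \<Omega>"
    unfolding g_def[abs_def] using f by (rule borel_L2_cmult)
  have "(g x)\<^sup>2 = 1 / s * (f x)\<^sup>2" for x
    using s by (simp add: g_def power_divide)
  then have "(LINT x|lborel. (g x)\<^sup>2) = 1"
    using s by (simp add: s_def[symmetric])
  then have le: "riesz_form \<beta> g g \<le> riesz_lambda1 \<alpha> \<Omega>"
    unfolding riesz_lambda1_borel using g by (intro cSup_upper bdd_above_riesz_form) auto
  have scaled: "g x * g y / k = 1 / s * (f x * f y / k)" for x y k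
    using s by (simp add: g_def)
  have "riesz_form \<beta> g g = 1 / s * riesz_form \<beta> f f"
    unfolding riesz_form_def scaled by (rule integral_mult_right_zero)
  with le s show ?thesis
    by (simp add: s_def[symmetric] field_simps)
qed

lemma riesz_lambda1_pos:
  assumes "\<Omega> \<noteq> {}"
  shows "0 < riesz_lambda1 \<alpha> \<Omega>"
proof -
  obtain D where D: "0 < D" "\<And>x y. x \<in> \<Omega> \<Longrightarrow> y \<in> \<Omega> \<Longrightarrow> norm (x - y) \<le> D"
    using bounded_norm_diff_le[OF \<Omega>(1)] by blast
  have ind: "(indicator \<Omega> :: 'a \<Rightarrow> real) \<in> borel_L2 \<Omega>"
    using \<Omega> by (intro indicator_in_borel_L2) auto
  have "0 < D powr (- \<beta>) * (measure lborel \<Omega> * measure lborel \<Omega>)"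
    using D measure_open_pos[OF \<Omega> assms] by simp
  also have "\<dots> \<le> riesz_form \<beta> (indicator \<Omega>) (indicator \<Omega>)"
    using riesz_form_ge[OF kernel_exponent_bounds \<Omega>(1) domain_borel ind _ ind _ D(2)] indicator_integrals[OF domain_borel]
    by simp
  also have "\<dots> \<le> riesz_lambda1 \<alpha> \<Omega> * measure lborel \<Omega>"
    using riesz_form_le_lambda1[OF ind] indicator_integrals[OF domain_borel] by simp
  finally show ?thesis
    using measure_open_pos[OF \<Omega> assms] by (simp add: zero_less_mult_iff)
qed

text \<open>Passing to the absolute value keeps the norm and does not decrease the energy, because the kernel
is nonnegative.\<close>

lemma ex_near_maximizer:
  assumes "\<Omega> \<noteq> {}" "0 < \<delta>"
  obtains f where "f \<in> borel_L2 \<Omega>" "\<And>x. 0 \<le> f x" "(LINT x|lborel. (f x)\<^sup>2) = 1"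
    "riesz_lambda1 \<alpha> \<Omega> - \<delta> < riesz_form \<beta> f f"
proof -
  let ?S = "{riesz_form \<beta> f f | f. f \<in> borel_L2 \<Omega> \<and> (LINT x|lborel. (f x)\<^sup>2) = 1}"
  have ind: "(indicator \<Omega> :: 'a \<Rightarrow> real) \<in> borel_L2 \<Omega>"
    using \<Omega> by (intro indicator_in_borel_L2) auto
  have "(LINT x|lborel. (1 / sqrt (measure lborel \<Omega>) * indicator \<Omega> x)\<^sup>2)
      = 1 / measure lborel \<Omega> * measure lborel \<Omega>"
    using indicator_integrals[OF domain_borel]
    by (simp add: power_mult_distrib power_divide del: times_divide_eq_left)
  also have "\<dots> = 1"
    using measure_open_pos[OF \<Omega> assms(1)] by simp
  finally have ne: "?S \<noteq> {}"
    using borel_L2_cmult[OF ind] by blast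
  have "riesz_lambda1 \<alpha> \<Omega> - \<delta> < Sup ?S"
    using assms(2) by (simp add: riesz_lambda1_borel)
  then obtain e where "e \<in> ?S" "riesz_lambda1 \<alpha> \<Omega> - \<delta> < e"
    using less_cSupD[OF ne] by blast
  then obtain f where f: "f \<in> borel_L2 \<Omega>" "(LINT x|lborel. (f x)\<^sup>2) = 1"
      "riesz_lambda1 \<alpha> \<Omega> - \<delta> < riesz_form \<beta> f f"
    by auto
  show thesis
  proof (rule that[of "\<lambda>x. \<bar>f x\<bar>"])
    show "riesz_lambda1 \<alpha> \<Omega> - \<delta> < riesz_form \<beta> (\<lambda>x. \<bar>f x\<bar>) (\<lambda>x. \<bar>f x\<bar>)"
      using f(3) riesz_form_le_abs[OF kernel_exponent_bounds \<Omega>(1) domain_borel f(1)] by linarith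
  qed (use f borel_L2_abs in auto)
qed

text \<open>The near part of the kernel, cut off at a radius where its integral is at most a quarter of the
eigenvalue, contributes at most half of the required energy; the rest must come from the \<open>L\<^sup>1\<close>
norm.\<close>

lemma near_maximizer_integral_ge:
  assumes "\<Omega> \<noteq> {}"
  obtains l where "0 < l"
    "\<And>u. u \<in> borel_L2 \<Omega> \<Longrightarrow> (\<And>x. 0 \<le> u x) \<Longrightarrow> (LINT x|lborel. (u x)\<^sup>2) = 1 \<Longrightarrow>
      riesz_lambda1 \<alpha> \<Omega> / 2 \<le> riesz_form \<beta> u u \<Longrightarrow> l \<le> integral\<^sup>L lborel u"
proof -
  define L where "L = riesz_lambda1 \<alpha> \<Omega>"
  have L: "0 < L"
    unfolding L_def using assms by (rule riesz_lambda1_pos)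
  obtain r where r: "0 < r" "(LINT z|(lborel :: 'a measure). indicator (ball 0 r) z / norm z powr \<beta>) \<le> L / 4"
    using integral_ball_inverse_norm_powr_small[OF kernel_exponent_bounds, of "L / 4"] L by auto
  show thesis
  proof (rule that[of "sqrt (L / 4 * r powr \<beta>)"])
    show "0 < sqrt (L / 4 * r powr \<beta>)"
      using L r by simp
    fix u assume u: "u \<in> borel_L2 \<Omega>" "\<And>x. 0 \<le> u x" "(LINT x|lborel. (u x)\<^sup>2) = 1"
      "riesz_lambda1 \<alpha> \<Omega> / 2 \<le> riesz_form \<beta> u u"
    have "L / 2 \<le> L / 4 + r powr (- \<beta>) * (integral\<^sup>L lborel u)\<^sup>2"
      using riesz_form_le[OF kernel_exponent_bounds \<Omega>(1) domain_borel u(1) r(1)] u(2-4) r(2) by (simp add: L_def)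
    then have "L / 4 * r powr \<beta> \<le> (integral\<^sup>L lborel u)\<^sup>2"
      using r(1) by (simp add: powr_minus field_simps)
    then show "sqrt (L / 4 * r powr \<beta>) \<le> integral\<^sup>L lborel u"
      using u(2) by (intro real_le_lsqrt) auto
  qed
qed

text \<open>The substitute for the positivity of an eigenfunction. Inserting \<open>u + t * indicator A\<close> into
\<open>riesz_form_le_lambda1\<close> yields, with \<open>\<lambda>\<close> the eigenvalue and \<open>X\<close> the integral of \<open>u\<close> over \<open>A\<close>,
\<open>2 t B(u, 1\<^sub>A) \<le> \<delta> + 2 t \<lambda> X + t\<^sup>2 \<lambda> |A|\<close>. Since \<open>B(u, 1\<^sub>A)\<close> has a positive lower bound \<open>P\<close> that does
not depend on \<open>u\<close>, a small \<open>t\<close> and then a small \<open>\<delta>\<close> force \<open>X\<close> to be at least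
\<open>P / (2 \<lambda>)\<close>.\<close>

lemma near_maximizer_mass:
  assumes A: "A \<in> sets borel" "A \<subseteq> \<Omega>" "0 < measure lborel A"
  shows "\<exists>m>0. \<exists>\<delta>>0. \<forall>u\<in>borel_L2 \<Omega>. (\<forall>x. 0 \<le> u x) \<and> (LINT x|lborel. (u x)\<^sup>2) = 1
      \<and> riesz_lambda1 \<alpha> \<Omega> - \<delta> \<le> riesz_form \<beta> u u
    \<longrightarrow> m \<le> (LINT x|lborel. u x * indicator A x)"
proof -
  define L where "L = riesz_lambda1 \<alpha> \<Omega>"
  have ne: "\<Omega> \<noteq> {}"
    using A by auto
  then have L: "0 < L"
    unfolding L_def by (rule riesz_lambda1_pos)
  obtain l where l: "0 < l"
    "\<And>u. u \<in> borel_L2 \<Omega> \<Longrightarrow> (\<And>x. 0 \<le> u x) \<Longrightarrow> (LINT x|lborel. (u x)\<^sup>2) = 1 \<Longrightarrow>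
      L / 2 \<le> riesz_form \<beta> u u \<Longrightarrow> l \<le> integral\<^sup>L lborel u"
    unfolding L_def using near_maximizer_integral_ge[OF ne] by metis
  obtain D where D: "0 < D" "\<And>x y. x \<in> \<Omega> \<Longrightarrow> y \<in> \<Omega> \<Longrightarrow> norm (x - y) \<le> D"
    using bounded_norm_diff_le[OF \<Omega>(1)] by blast
  define P where "P = D powr (- \<beta>) * (l * measure lborel A)"
  \<comment> \<open>This choice makes the term quadratic in \<open>t\<close> equal to \<open>t * (P / 2)\<close>; the cap on \<open>\<delta>\<close> below makes the energy defect at most as large.\<close>
  define t where "t = P / (2 * L * measure lborel A)"
  have P: "0 < P"
    using D(1) l(1) A(3) by (simp add: P_def)
  then have t: "0 < t" "t * (L * measure lborel A) = P / 2"
    using L A(3) by (simp_all add: t_def)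
  define \<delta> where "\<delta> = min (L / 2) (t * P / 2)"
  have ind: "(indicator A :: 'a \<Rightarrow> real) \<in> borel_L2 \<Omega>"
    using \<Omega>(1) A by (intro indicator_in_borel_L2)
  have ind0: "0 \<le> riesz_form \<beta> (indicator A) (indicator A)"
    by (simp add: riesz_form_def)
  have "P / (2 * L) \<le> (LINT x|lborel. u x * indicator A x)"
    if u: "u \<in> borel_L2 \<Omega>" "\<And>x. 0 \<le> u x" "(LINT x|lborel. (u x)\<^sup>2) = 1"
      "riesz_lambda1 \<alpha> \<Omega> - \<delta> \<le> riesz_form \<beta> u u" for u
  proof -
    let ?X = "LINT x|lborel. u x * indicator A x"
    have "L / 2 \<le> riesz_form \<beta> u u"
      using u(4) by (simp add: L_def[symmetric] \<delta>_def)
    then have "l \<le> integral\<^sup>L lborel u"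
      using l(2) u(1-3) by blast
    then have "P \<le> D powr (- \<beta>) * (integral\<^sup>L lborel u * measure lborel A)"
      unfolding P_def by (intro mult_left_mono mult_right_mono) auto
    also have "\<dots> \<le> riesz_form \<beta> u (indicator A)"
      using riesz_form_ge[OF kernel_exponent_bounds \<Omega>(1) domain_borel u(1,2) ind _ D(2)] indicator_integrals(1)[OF A(1)]
      by simp
    finally have "P \<le> riesz_form \<beta> u (indicator A)" .
    then have "L - \<delta> + 2 * t * P + t\<^sup>2 * 0
        \<le> riesz_form \<beta> u u + 2 * t * riesz_form \<beta> u (indicator A)
          + t\<^sup>2 * riesz_form \<beta> (indicator A) (indicator A)"
      using u(4) t(1) ind0 by (intro add_mono mult_left_mono) (auto simp: L_def)
    also have "\<dots> \<le> L * (1 + 2 * t * ?X + t\<^sup>2 * measure lborel A)"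
      using riesz_form_le_lambda1[OF borel_L2_add[OF u(1) ind, of t]]
      unfolding integral_square_add[OF u(1) ind]
        riesz_form_add[OF kernel_exponent_bounds \<Omega>(1) domain_borel u(1) ind]
      by (simp add: u(3) indicator_integrals[OF A(1)] L_def)
    also have "\<dots> = L + t * (2 * (L * ?X)) + t * (t * (L * measure lborel A))"
      by (simp add: algebra_simps power2_eq_square)
    finally have "t * (2 * P) \<le> t * (2 * (L * ?X)) + t * (P / 2) + \<delta>"
      unfolding t(2) by simp
    moreover have "\<delta> \<le> t * (P / 2)"
      by (simp add: \<delta>_def)
    moreover have "t * (2 * (L * ?X) + P) = t * (2 * (L * ?X)) + t * (P / 2) + t * (P / 2)"
      by (simp add: distrib_left)
    ultimately have "t * (2 * P) \<le> t * (2 * (L * ?X) + P)"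
      by linarith
    then have "2 * P \<le> 2 * (L * ?X) + P"
      using t(1) by (rule mult_left_le_imp_le)
    then show ?thesis
      using L by (simp add: field_simps)
  qed
  moreover have "0 < P / (2 * L)" "0 < \<delta>"
    using P L t by (auto simp: \<delta>_def)
  ultimately show ?thesis
    by blast
qed

end

section \<open>Reflections and two-point rearrangement\<close>

text \<open>The reflection in the hyperplane \<open>a \<bullet> x = b\<close>, as an explicit formula.\<close>

definition mirror :: "'a::euclidean_space \<Rightarrow> real \<Rightarrow> 'a \<Rightarrow> 'a" where
  "mirror a b x = x - (2 * (a \<bullet> x - b) / (a \<bullet> a)) *\<^sub>R a"

text \<open>The function analogue of polarization.\<close>

definition two_point :: "'a::euclidean_space \<Rightarrow> real \<Rightarrow> ('a \<Rightarrow> real) \<Rightarrow> 'a \<Rightarrow> real" where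
  "two_point a b u x =
    (if a \<bullet> x < b then max (u x) (u (mirror a b x)) else min (u x) (u (mirror a b x)))"

lemma integral_product_preserving:
  fixes F :: "'a::euclidean_space \<times> 'a \<Rightarrow> real" and S T :: "'a \<Rightarrow> 'a"
  assumes S: "S \<in> borel_measurable borel" "distr lborel borel S = lborel"
    and T: "T \<in> borel_measurable borel" "distr lborel borel T = lborel"
    and F: "integrable (lborel \<Otimes>\<^sub>M lborel) F"
  shows "integrable (lborel \<Otimes>\<^sub>M lborel) (\<lambda>z. F (S (fst z), T (snd z)))"
    and "(LINT z|(lborel \<Otimes>\<^sub>M lborel). F (S (fst z), T (snd z))) = integral\<^sup>L (lborel \<Otimes>\<^sub>M lborel) F"
proof -
  let ?M = "lborel \<Otimes>\<^sub>M lborel :: ('a \<times> 'a) measure"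
  note [measurable] = S(1) T(1)
  have "sigma_finite_measure (distr lborel borel T)"
    unfolding T(2) by (rule sigma_finite_lborel)
  then have "distr lborel borel S \<Otimes>\<^sub>M distr lborel borel T
      = distr ?M (borel \<Otimes>\<^sub>M borel) (\<lambda>(x, y). (S x, T y))"
    by (intro pair_measure_distr) simp_all
  then have d: "distr ?M (borel \<Otimes>\<^sub>M borel) (\<lambda>z. (S (fst z), T (snd z))) = ?M"
    unfolding S(2) T(2) by (simp add: split_beta')
  have m: "(\<lambda>z. (S (fst z), T (snd z))) \<in> ?M \<rightarrow>\<^sub>M borel \<Otimes>\<^sub>M borel"
    by measurable
  have F': "F \<in> borel_measurable (borel \<Otimes>\<^sub>M borel)"
    using borel_measurable_integrable[OF F] by measurable
  show "integrable ?M (\<lambda>z. F (S (fst z), T (snd z)))"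
    using integrable_distr_eq[OF m F'] F by (simp add: d)
  show "(LINT z|?M. F (S (fst z), T (snd z))) = integral\<^sup>L ?M F"
    using integral_distr[OF m F'] by (simp add: d)
qed

lemma two_point_sum_mono:
  fixes p p' q q' :: real
  shows "p * q + p' * q' \<le> max p p' * max q q' + min p p' * min q q'"
    and "max p p' * min q q' + min p p' * max q q' \<le> p * q + p' * q'"
proof -
  have "0 \<le> (p' - p) * (q' - q)" if "p \<le> p'" "q \<le> q'"
    using that by simp
  moreover have "0 \<le> (p - p') * (q - q')" if "p' \<le> p" "q' \<le> q"
    using that by simp
  moreover have "0 \<le> (p' - p) * (q - q')" if "p \<le> p'" "q' \<le> q"
    using that by simp
  moreover have "0 \<le> (p - p') * (q' - q)" if "p' \<le> p" "q \<le> q'"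
    using that by simp
  ultimately show "p * q + p' * q' \<le> max p p' * max q q' + min p p' * min q q'"
    and "max p p' * min q q' + min p p' * max q q' \<le> p * q + p' * q'"
    by (auto simp: max_def min_def algebra_simps)
qed

lemma inverse_powr_gap_pos:
  fixes h D \<beta> :: real
  assumes "0 < D" "0 < h" "0 < \<beta>"
  shows "0 < 1 / D powr \<beta> * (1 - sqrt (D\<^sup>2 / (D\<^sup>2 + h)) powr \<beta>)"
  using powr_less_mono2[of \<beta> "sqrt (D\<^sup>2 / (D\<^sup>2 + h))" 1] assms by (simp add: add_pos_pos)

text \<open>The difference is \<open>1 / r powr \<beta> * (1 - (r / r') powr \<beta>)\<close>, and both factors are smallest when \<open>r\<close>
takes its largest value \<open>D\<close> and \<open>r'\<close> its smallest.\<close>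

lemma inverse_powr_gap_ge:
  fixes r r' h D \<beta> :: real
  assumes "0 < r" "r \<le> D" "0 < h" "0 < \<beta>" "r\<^sup>2 + h \<le> r'\<^sup>2" "0 < r'"
  shows "1 / D powr \<beta> * (1 - sqrt (D\<^sup>2 / (D\<^sup>2 + h)) powr \<beta>) \<le> 1 / r powr \<beta> - 1 / r' powr \<beta>"
proof -
  have D: "0 < D" using assms by simp
  have "(r / r')\<^sup>2 \<le> r\<^sup>2 / (r\<^sup>2 + h)"
    unfolding power_divide using assms by (intro divide_left_mono) (auto simp: add_pos_pos)
  also have "\<dots> \<le> D\<^sup>2 / (D\<^sup>2 + h)"
  proof -
    have "r\<^sup>2 \<le> D\<^sup>2" using assms by (intro power_mono) auto
    then have "r\<^sup>2 * h \<le> D\<^sup>2 * h" using assms by (intro mult_right_mono) auto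
    then show ?thesis
      using assms D by (simp add: divide_simps add_pos_pos algebra_simps)
  qed
  finally have "r / r' \<le> sqrt (D\<^sup>2 / (D\<^sup>2 + h))"
    by (rule real_le_rsqrt)
  then have "(r / r') powr \<beta> \<le> sqrt (D\<^sup>2 / (D\<^sup>2 + h)) powr \<beta>"
    using assms by (intro powr_mono2) auto
  moreover have "sqrt (D\<^sup>2 / (D\<^sup>2 + h)) powr \<beta> \<le> 1"
    using inverse_powr_gap_pos[OF D assms(3,4)] D by (simp add: zero_less_mult_iff zero_less_divide_iff)
  moreover have "1 / D powr \<beta> \<le> 1 / r powr \<beta>"
    using assms D by (intro divide_left_mono powr_mono2) auto
  ultimately have "1 / D powr \<beta> * (1 - sqrt (D\<^sup>2 / (D\<^sup>2 + h)) powr \<beta>)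
      \<le> 1 / r powr \<beta> * (1 - (r / r') powr \<beta>)"
    using assms D by (intro mult_mono) auto
  also have "\<dots> = 1 / r powr \<beta> - 1 / r' powr \<beta>"
    using assms by (simp add: powr_divide right_diff_distrib)
  finally show ?thesis .
qed

context
  fixes a :: "'a::euclidean_space" and b :: real
  assumes a: "a \<noteq> 0"
begin

abbreviation (input) "\<sigma> \<equiv> mirror a b"

lemma mirror_level: "a \<bullet> mirror a b x - b = - (a \<bullet> x - b)"
  using a by (simp add: mirror_def inner_diff_right)

lemma mirror_side: "a \<bullet> mirror a b x < b \<longleftrightarrow> b < a \<bullet> x"
  using mirror_level[of x] by linarith

lemma mirror_mirror: "mirror a b (mirror a b x) = x"
proof -
  have "mirror a b (mirror a b x)
      = mirror a b x - (2 * (a \<bullet> mirror a b x - b) / (a \<bullet> a)) *\<^sub>R a"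
    by (subst mirror_def) (rule refl)
  also have "\<dots> = mirror a b x + (2 * (a \<bullet> x - b) / (a \<bullet> a)) *\<^sub>R a"
    unfolding mirror_level by (simp add: minus_divide_left[symmetric] del: minus_diff_eq)
  also have "\<dots> = x"
    by (simp add: mirror_def)
  finally show ?thesis .
qed

lemma mirror_on_hyperplane: "a \<bullet> x = b \<Longrightarrow> mirror a b x = x"
  by (simp add: mirror_def)

text \<open>This identity decides which of \<open>y\<close> and its mirror image is closer to \<open>x\<close>, and by how much: the
added term is four times the product of the signed distances of \<open>x\<close> and \<open>y\<close> to the hyperplane.\<close>

lemma mirror_dist_square:
  "(norm (x - mirror a b y))\<^sup>2 = (norm (x - y))\<^sup>2 + 4 * ((a \<bullet> x - b) * (a \<bullet> y - b)) / (a \<bullet> a)"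
proof -
  define t where "t = 2 * (a \<bullet> y - b) / (a \<bullet> a)"
  have aa: "a \<bullet> a \<noteq> 0"
    using a by simp
  have diff: "x - mirror a b y = (x - y) + t *\<^sub>R a"
    by (simp add: mirror_def t_def)
  have "(norm (x - mirror a b y))\<^sup>2 = (norm (x - y))\<^sup>2 + t * (2 * (a \<bullet> x - a \<bullet> y) + t * (a \<bullet> a))"
    unfolding diff power2_norm_eq_inner
    by (simp add: inner_add_left inner_add_right inner_diff_left inner_diff_right inner_commute
        distrib_left distrib_right right_diff_distrib)
  also have "t * (a \<bullet> a) = 2 * (a \<bullet> y - b)"
    using aa by (simp add: t_def)
  also have "t * (2 * (a \<bullet> x - a \<bullet> y) + 2 * (a \<bullet> y - b)) = 4 * ((a \<bullet> x - b) * (a \<bullet> y - b)) / (a \<bullet> a)"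
    by (simp add: t_def algebra_simps)
  finally show ?thesis .
qed

lemma norm_mirror_right: "norm (mirror a b x - y) = norm (x - mirror a b y)"
proof -
  have "(norm (y - mirror a b x))\<^sup>2 = (norm (x - mirror a b y))\<^sup>2"
    unfolding mirror_dist_square by (simp add: norm_minus_commute algebra_simps)
  then show ?thesis
    by (simp add: norm_minus_commute power2_eq_iff_nonneg)
qed

lemma norm_mirror_mirror: "norm (mirror a b x - mirror a b y) = norm (x - y)"
  using norm_mirror_right[of x "mirror a b y"] by (simp add: mirror_mirror)

lemma mirror_continuous: "continuous_on S (mirror a b)"
  unfolding mirror_def by (intro continuous_intros) (use a in auto)

lemma mirror_measurable [measurable]: "mirror a b \<in> borel_measurable borel"
  by (rule borel_measurable_continuous_onI) (rule mirror_continuous)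

lemma lborel_distr_mirror: "distr lborel borel (mirror a b) = lborel"
proof -
  define L where "L x = x - (2 * (a \<bullet> x) / (a \<bullet> a)) *\<^sub>R a" for x
  have lin: "linear L"
  proof (rule linearI)
    show "L (x + y) = L x + L y" for x y
      by (simp add: L_def inner_add_right distrib_left add_divide_distrib scaleR_add_left)
    show "L (r *\<^sub>R x) = r *\<^sub>R L x" for r x
      by (simp add: L_def scaleR_diff_right mult.left_commute)
  qed
  have "norm (L x) = norm x" for x
  proof -
    have "L x = mirror a b x - mirror a b 0"
      by (simp add: L_def mirror_def algebra_simps diff_divide_distrib)
    then show ?thesis
      using norm_mirror_mirror[of x 0] by simp
  qed
  with lin have L: "orthogonal_transformation L"
    by (simp add: orthogonal_transformation)
  have [measurable]: "L \<in> borel_measurable borel"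
    using lin by (intro borel_measurable_continuous_onI linear_continuous_on)
      (simp add: linear_linear)
  have "mirror a b = (+) ((2 * b / (a \<bullet> a)) *\<^sub>R a) \<circ> L"
    by (auto simp: fun_eq_iff mirror_def L_def algebra_simps diff_divide_distrib)
  then have "distr lborel borel (mirror a b)
      = distr (distr lborel borel L) borel ((+) ((2 * b / (a \<bullet> a)) *\<^sub>R a))"
    by (simp add: distr_distr)
  then show ?thesis
    by (simp add: lborel_distr_orthogonal_transformation[OF L] lborel_distr_plus)
qed

lemma integral_mirror:
  fixes h :: "'a \<Rightarrow> real"
  assumes "h \<in> borel_measurable borel"
  shows "(LINT x|lborel. h (mirror a b x)) = integral\<^sup>L lborel h"
    and "integrable lborel (\<lambda>x. h (mirror a b x)) \<longleftrightarrow> integrable lborel h"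
  using assms integral_distr[of "mirror a b" lborel borel h]
    integrable_distr_eq[of "mirror a b" lborel borel h] by (simp_all add: lborel_distr_mirror)

lemma emeasure_mirror:
  assumes "A \<in> sets borel"
  shows "emeasure lborel {x. mirror a b x \<in> A} = emeasure lborel A"
  using assms emeasure_distr[of "mirror a b" lborel borel A]
  by (simp add: lborel_distr_mirror vimage_def)

lemma reflect_bdry_eq_mirror: "reflect_bdry {x. a \<bullet> x < b} = mirror a b"
  using reflect_bdry_halfspace[OF a] by (auto simp: fun_eq_iff mirror_def)

lemma mem_mirror_image: "x \<in> mirror a b ` \<Omega> \<longleftrightarrow> mirror a b x \<in> \<Omega>"
  by (metis imageE imageI mirror_mirror)

lemma mem_polarization:
  "x \<in> polarization {x. a \<bullet> x < b} \<Omega> \<longleftrightarrow>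
    (if a \<bullet> x < b then x \<in> \<Omega> \<or> mirror a b x \<in> \<Omega> else x \<in> \<Omega> \<and> mirror a b x \<in> \<Omega>)"
  by (auto simp: polarization_def reflect_bdry_eq_mirror mem_mirror_image)

lemma open_mirror_image: "open \<Omega> \<Longrightarrow> open (mirror a b ` \<Omega>)"
proof -
  assume "open \<Omega>"
  moreover have "mirror a b ` \<Omega> = mirror a b -` \<Omega>"
    by (intro set_eqI) (simp add: mem_mirror_image)
  ultimately show ?thesis
    by (simp add: open_vimage mirror_continuous)
qed

lemma bounded_mirror_image: "bounded \<Omega> \<Longrightarrow> bounded (mirror a b ` \<Omega>)"
proof -
  assume "bounded \<Omega>"
  then have "compact (mirror a b ` closure \<Omega>)"
    by (intro compact_continuous_image mirror_continuous) (simp add: compact_closure)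
  then show ?thesis
    by (meson bounded_subset closure_subset compact_imp_bounded image_mono)
qed

lemma open_polarization: "open \<Omega> \<Longrightarrow> open (polarization {x. a \<bullet> x < b} \<Omega>)"
  unfolding polarization_def reflect_bdry_eq_mirror
  by (intro open_Un open_Int open_mirror_image open_halfspace_lt)

lemma bounded_polarization: "bounded \<Omega> \<Longrightarrow> bounded (polarization {x. a \<bullet> x < b} \<Omega>)"
  unfolding polarization_def reflect_bdry_eq_mirror
  using bounded_mirror_image by (simp add: bounded_Int)

text \<open>At a pair of mirror points the rearrangement either keeps or swaps the two values, so symmetric
functions of the two values are preserved.\<close>

lemma two_point_permutes:
  "two_point a b u x = u x \<and> two_point a b u (\<sigma> x) = u (\<sigma> x)
    \<or> two_point a b u x = u (\<sigma> x) \<and> two_point a b u (\<sigma> x) = u x"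
proof (cases "a \<bullet> x = b")
  case True
  then show ?thesis
    by (simp add: mirror_on_hyperplane two_point_def)
next
  case False
  then show ?thesis
    by (cases "a \<bullet> x < b")
      (simp_all add: two_point_def mirror_side mirror_mirror max_def min_def)
qed

lemma two_point_pair: "two_point a b u x + two_point a b u (\<sigma> x) = u x + u (\<sigma> x)"
  and two_point_pair_square:
    "(two_point a b u x)\<^sup>2 + (two_point a b u (\<sigma> x))\<^sup>2 = (u x)\<^sup>2 + (u (\<sigma> x))\<^sup>2"
  using two_point_permutes[of u x] by auto

lemma two_point_measurable [measurable]:
  assumes [measurable]: "u \<in> borel_measurable borel"
  shows "two_point a b u \<in> borel_measurable borel"
  unfolding two_point_def[abs_def] by measurable

lemma two_point_integral_square:
  assumes u: "u \<in> borel_measurable borel" "integrable lborel (\<lambda>x. (u x)\<^sup>2)"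
  shows "integrable lborel (\<lambda>x. (two_point a b u x)\<^sup>2)"
    and "(LINT x|lborel. (two_point a b u x)\<^sup>2) = (LINT x|lborel. (u x)\<^sup>2)"
proof -
  note [measurable] = u(1)
  let ?v = "two_point a b u"
  have u\<sigma>: "integrable lborel (\<lambda>x. (u (\<sigma> x))\<^sup>2)" "(LINT x|lborel. (u (\<sigma> x))\<^sup>2) = (LINT x|lborel. (u x)\<^sup>2)"
    using integral_mirror[of "\<lambda>x. (u x)\<^sup>2"] u by simp_all
  show v: "integrable lborel (\<lambda>x. (?v x)\<^sup>2)"
  proof (rule Bochner_Integration.integrable_bound)
    show "integrable lborel (\<lambda>x. (u x)\<^sup>2 + (u (\<sigma> x))\<^sup>2)"
      using u u\<sigma> by simp
    show "AE x in lborel. norm ((?v x)\<^sup>2) \<le> norm ((u x)\<^sup>2 + (u (\<sigma> x))\<^sup>2)"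
    proof (intro AE_I2)
      fix x
      show "norm ((?v x)\<^sup>2) \<le> norm ((u x)\<^sup>2 + (u (\<sigma> x))\<^sup>2)"
        unfolding two_point_pair_square[of u x, symmetric] by simp
    qed
  qed measurable
  have v\<sigma>: "integrable lborel (\<lambda>x. (?v (\<sigma> x))\<^sup>2)" "(LINT x|lborel. (?v (\<sigma> x))\<^sup>2) = (LINT x|lborel. (?v x)\<^sup>2)"
    using integral_mirror[of "\<lambda>x. (?v x)\<^sup>2"] v by simp_all
  have "(LINT x|lborel. (?v x)\<^sup>2 + (?v (\<sigma> x))\<^sup>2) = (LINT x|lborel. (u x)\<^sup>2 + (u (\<sigma> x))\<^sup>2)"
    by (simp only: two_point_pair_square)
  then show "(LINT x|lborel. (?v x)\<^sup>2) = (LINT x|lborel. (u x)\<^sup>2)"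
    using v v\<sigma> u(2) u\<sigma> by simp
qed

lemma two_point_in_borel_L2:
  assumes u: "u \<in> borel_L2 \<Omega>" "\<And>x. 0 \<le> u x"
  shows "two_point a b u \<in> borel_L2 (polarization {x. a \<bullet> x < b} \<Omega>)"
proof -
  have "two_point a b u x = 0" if "x \<notin> polarization {x. a \<bullet> x < b} \<Omega>" for x
  proof (cases "a \<bullet> x < b")
    case True
    then have "u x = 0" "u (\<sigma> x) = 0"
      using that borel_L2_zero[OF u(1)] by (simp_all add: mem_polarization)
    then show ?thesis
      by (simp add: two_point_def)
  next
    case False
    then have "u x = 0 \<or> u (\<sigma> x) = 0"
      using that borel_L2_zero[OF u(1)] by (auto simp: mem_polarization)
    then show ?thesis
      using False u(2)[of x] u(2)[of "\<sigma> x"] by (auto simp: two_point_def min_def)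
  qed
  then show ?thesis
    using two_point_measurable[OF borel_L2_measurable[OF u(1)]]
      two_point_integral_square(1)[OF borel_L2_measurable[OF u(1)] borel_L2_square[OF u(1)]]
    by (simp add: borel_L2_def)
qed

text \<open>The energy integral is invariant under reflecting \<open>x\<close>, or \<open>y\<close>, or both; adding the four versions
gives an integrand that is symmetric under each of the reflections.\<close>

lemma riesz_form_symmetrized:
  fixes \<beta> :: real and u :: "'a \<Rightarrow> real"
  defines "S \<equiv> \<lambda>z. (u (fst z) * u (snd z) + u (\<sigma> (fst z)) * u (\<sigma> (snd z)))
        / norm (fst z - snd z) powr \<beta>
      + (u (fst z) * u (\<sigma> (snd z)) + u (\<sigma> (fst z)) * u (snd z))
        / norm (fst z - \<sigma> (snd z)) powr \<beta>"
  assumes F: "integrable (lborel \<Otimes>\<^sub>M lborel)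
      (\<lambda>z. u (fst z) * u (snd z) / norm (fst z - snd z) powr \<beta>)"
  shows "integrable (lborel \<Otimes>\<^sub>M lborel) S"
    and "integral\<^sup>L (lborel \<Otimes>\<^sub>M lborel) S = 4 * riesz_form \<beta> u u"
proof -
  have id: "(\<lambda>x::'a. x) \<in> borel_measurable borel" "distr lborel borel (\<lambda>x::'a. x) = lborel"
    by (simp_all add: distr_id2)
  note \<sigma> = mirror_measurable lborel_distr_mirror
  note p1 = integral_product_preserving[OF \<sigma> \<sigma> F, simplified]
  note p2 = integral_product_preserving[OF id \<sigma> F, simplified]
  note p3 = integral_product_preserving[OF \<sigma> id F, simplified]
  have S: "S = (\<lambda>z. (u (fst z) * u (snd z) / norm (fst z - snd z) powr \<beta>
      + u (\<sigma> (fst z)) * u (\<sigma> (snd z)) / norm (\<sigma> (fst z) - \<sigma> (snd z)) powr \<beta>)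
      + (u (fst z) * u (\<sigma> (snd z)) / norm (fst z - \<sigma> (snd z)) powr \<beta>
      + u (\<sigma> (fst z)) * u (snd z) / norm (\<sigma> (fst z) - snd z) powr \<beta>))"
    by (simp add: S_def norm_mirror_right mirror_mirror add_divide_distrib)
  show "integrable (lborel \<Otimes>\<^sub>M lborel) S"
    unfolding S by (intro Bochner_Integration.integrable_add F p1 p2 p3)
  show "integral\<^sup>L (lborel \<Otimes>\<^sub>M lborel) S = 4 * riesz_form \<beta> u u"
    unfolding S using F p1 p2 p3 by (simp add: riesz_form_def)
qed

text \<open>The sum of the coefficients of \<open>k\<close> and \<open>k'\<close> is \<open>(u x + u (\<sigma> x)) * (u y + u (\<sigma> y))\<close>, which
rearrangement preserves. So the two coefficients change by opposite amounts.\<close>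

lemma symmetrized_difference:
  fixes u :: "'a \<Rightarrow> real" and k k' :: real and x y :: 'a
  defines "v \<equiv> two_point a b u"
  shows "((v x * v y + v (\<sigma> x) * v (\<sigma> y)) * k + (v x * v (\<sigma> y) + v (\<sigma> x) * v y) * k')
      - ((u x * u y + u (\<sigma> x) * u (\<sigma> y)) * k + (u x * u (\<sigma> y) + u (\<sigma> x) * u y) * k')
    = (k - k') * ((v x * v y + v (\<sigma> x) * v (\<sigma> y)) - (u x * u y + u (\<sigma> x) * u (\<sigma> y)))"
proof -
  have cross: "f x * f (\<sigma> y) + f (\<sigma> x) * f y
      = (f x + f (\<sigma> x)) * (f y + f (\<sigma> y)) - (f x * f y + f (\<sigma> x) * f (\<sigma> y))" for f :: "'a \<Rightarrow> real"
    by (simp add: algebra_simps)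
  have sums: "v x + v (\<sigma> x) = u x + u (\<sigma> x)" "v y + v (\<sigma> y) = u y + u (\<sigma> y)"
    unfolding v_def by (rule two_point_pair)+
  show ?thesis
    unfolding cross[of v] cross[of u] sums by (simp add: algebra_simps)
qed

text \<open>For \<open>x\<close> and \<open>y\<close> on the same side, \<open>y\<close> is closer to \<open>x\<close> than \<open>\<sigma> y\<close> is, and the rearranged values
are ordered alike; on opposite sides both statements are reversed. On the hyperplane the two
kernels agree. The excluded points are those where one of the kernels has its default value
\<open>0\<close>.\<close>

lemma symmetrized_mono:
  fixes \<beta> :: real and u :: "'a \<Rightarrow> real"
  defines "v \<equiv> two_point a b u"
  assumes \<beta>: "0 < \<beta>" and xy: "y \<noteq> x" "y \<noteq> \<sigma> x"
  shows "(u x * u y + u (\<sigma> x) * u (\<sigma> y)) / norm (x - y) powr \<beta>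
        + (u x * u (\<sigma> y) + u (\<sigma> x) * u y) / norm (x - \<sigma> y) powr \<beta>
      \<le> (v x * v y + v (\<sigma> x) * v (\<sigma> y)) / norm (x - y) powr \<beta>
        + (v x * v (\<sigma> y) + v (\<sigma> x) * v y) / norm (x - \<sigma> y) powr \<beta>"
proof -
  define k where "k = 1 / norm (x - y) powr \<beta>"
  define k' where "k' = 1 / norm (x - \<sigma> y) powr \<beta>"
  define V where "V = v x * v y + v (\<sigma> x) * v (\<sigma> y)"
  define U where "U = u x * u y + u (\<sigma> x) * u (\<sigma> y)"
  have pos: "0 < norm (x - y)" "0 < norm (x - \<sigma> y)"
    using xy mirror_mirror by auto
  have "0 \<le> (k - k') * (V - U)"
  proof (cases "a \<bullet> x = b \<or> a \<bullet> y = b")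
    case True
    then have "(norm (x - \<sigma> y))\<^sup>2 = (norm (x - y))\<^sup>2"
      by (auto simp: mirror_dist_square)
    then have "norm (x - \<sigma> y) = norm (x - y)"
      by (simp add: power2_eq_iff_nonneg)
    then show ?thesis
      by (simp add: k_def k'_def)
  next
    case False
    show ?thesis
    proof (cases "(a \<bullet> x < b) = (a \<bullet> y < b)")
      case True
      then have "0 \<le> (a \<bullet> x - b) * (a \<bullet> y - b)"
        using False by (auto simp: zero_le_mult_iff)
      then have "(norm (x - y))\<^sup>2 \<le> (norm (x - \<sigma> y))\<^sup>2"
        by (simp add: mirror_dist_square)
      then have "norm (x - y) \<le> norm (x - \<sigma> y)"
        by (rule power2_le_imp_le) simp
      then have "k' \<le> k"
        unfolding k_def k'_def using pos \<beta> by (intro divide_left_mono powr_mono2) auto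
      moreover have "U \<le> V"
        using True False mirror_level[of x] mirror_level[of y]
          two_point_sum_mono(1)[of "u x" "u y" "u (\<sigma> x)" "u (\<sigma> y)"]
        by (auto simp: U_def V_def v_def two_point_def mirror_mirror max.commute min.commute)
      ultimately show ?thesis
        by simp
    next
      case opp: False
      then have "(a \<bullet> x - b) * (a \<bullet> y - b) \<le> 0"
        using False by (auto simp: mult_le_0_iff)
      then have "4 * ((a \<bullet> x - b) * (a \<bullet> y - b)) / (a \<bullet> a) \<le> 0"
        by (simp add: divide_nonpos_nonneg)
      then have "(norm (x - \<sigma> y))\<^sup>2 \<le> (norm (x - y))\<^sup>2"
        by (simp add: mirror_dist_square)
      then have "norm (x - \<sigma> y) \<le> norm (x - y)"
        by (rule power2_le_imp_le) simp
      then have "k \<le> k'"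
        unfolding k_def k'_def using pos \<beta> by (intro divide_left_mono powr_mono2) auto
      moreover have "V \<le> U"
        using opp False mirror_level[of x] mirror_level[of y]
          two_point_sum_mono(2)[of "u x" "u (\<sigma> x)" "u y" "u (\<sigma> y)"]
        by (auto simp: U_def V_def v_def two_point_def mirror_mirror max.commute min.commute)
      ultimately show ?thesis
        by (simp add: mult_nonpos_nonpos)
    qed
  qed
  also have "\<dots> = ((v x * v y + v (\<sigma> x) * v (\<sigma> y)) * k + (v x * v (\<sigma> y) + v (\<sigma> x) * v y) * k')
      - ((u x * u y + u (\<sigma> x) * u (\<sigma> y)) * k + (u x * u (\<sigma> y) + u (\<sigma> x) * u y) * k')"
    unfolding U_def V_def v_def by (rule symmetrized_difference[symmetric])
  finally show ?thesis
    by (simp add: k_def k'_def)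
qed

text \<open>Here only \<open>u x\<close> and \<open>u (\<sigma> y)\<close> can be nonzero, so rearrangement moves the value at \<open>\<sigma> y\<close> to \<open>y\<close> and
replaces the kernel at \<open>x - \<sigma> y\<close> by the larger one at \<open>x - y\<close>.\<close>

lemma symmetrized_gain:
  fixes \<beta> c :: real and u :: "'a \<Rightarrow> real"
  defines "v \<equiv> two_point a b u"
  assumes u: "\<And>x. 0 \<le> u x" and x: "a \<bullet> x < b" "u (\<sigma> x) = 0" and y: "a \<bullet> y < b" "u y = 0"
    and c: "c \<le> 1 / norm (x - y) powr \<beta> - 1 / norm (x - \<sigma> y) powr \<beta>"
  shows "(u x * u y + u (\<sigma> x) * u (\<sigma> y)) / norm (x - y) powr \<beta>
        + (u x * u (\<sigma> y) + u (\<sigma> x) * u y) / norm (x - \<sigma> y) powr \<beta> + c * (u x * u (\<sigma> y))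
      \<le> (v x * v y + v (\<sigma> x) * v (\<sigma> y)) / norm (x - y) powr \<beta>
        + (v x * v (\<sigma> y) + v (\<sigma> x) * v y) / norm (x - \<sigma> y) powr \<beta>"
proof -
  have v: "v x = u x" "v (\<sigma> x) = 0" "v y = u (\<sigma> y)" "v (\<sigma> y) = 0"
    using x y u mirror_level[of x] mirror_level[of y]
    by (auto simp: v_def two_point_def mirror_mirror max_def min_def antisym)
  have "c * (u x * u (\<sigma> y))
      \<le> (1 / norm (x - y) powr \<beta> - 1 / norm (x - \<sigma> y) powr \<beta>) * (u x * u (\<sigma> y))"
    using c u by (intro mult_right_mono) auto
  then show ?thesis
    by (simp add: v x y left_diff_distrib)
qed

text \<open>The rearrangement inequality with a lower bound on the gain. Empty sets \<open>A\<close> and \<open>B\<close> give plain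
monotonicity.\<close>

lemma riesz_form_two_point:
  fixes \<beta> c :: real
  assumes \<beta>: "0 < \<beta>" "\<beta> < real DIM('a)" and \<Omega>: "bounded \<Omega>" "open \<Omega>"
    and u: "u \<in> borel_L2 \<Omega>" "\<And>x. 0 \<le> u x"
    and A: "A \<in> sets borel" "\<And>x. x \<in> A \<Longrightarrow> a \<bullet> x < b \<and> \<sigma> x \<notin> \<Omega>"
    and B: "B \<in> sets borel" "\<And>y. y \<in> B \<Longrightarrow> a \<bullet> y < b \<and> y \<notin> \<Omega>"
    and c: "\<And>x y. x \<in> A \<Longrightarrow> y \<in> B \<Longrightarrow> x \<noteq> y \<Longrightarrow>
      c \<le> 1 / norm (x - y) powr \<beta> - 1 / norm (x - \<sigma> y) powr \<beta>"
  shows "riesz_form \<beta> u u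
      + c / 4 * ((LINT x|lborel. u x * indicator A x) * (LINT y|lborel. u (\<sigma> y) * indicator B y))
    \<le> riesz_form \<beta> (two_point a b u) (two_point a b u)"
proof -
  define v where "v = two_point a b u"
  define S where "S f z = (f (fst z) * f (snd z) + f (\<sigma> (fst z)) * f (\<sigma> (snd z)))
        / norm (fst z - snd z) powr \<beta>
      + (f (fst z) * f (\<sigma> (snd z)) + f (\<sigma> (fst z)) * f (snd z))
        / norm (fst z - \<sigma> (snd z)) powr \<beta>" for f :: "'a \<Rightarrow> real" and z
  define G where "G z = c * ((u (fst z) * indicator A (fst z)) * (u (\<sigma> (snd z)) * indicator B (snd z)))" for z
  have um [measurable]: "u \<in> borel_measurable borel"
    by (rule borel_L2_measurable[OF u(1)])
  have \<Omega>': "\<Omega> \<in> sets borel"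
    using \<Omega> by simp
  have v: "v \<in> borel_L2 (polarization {x. a \<bullet> x < b} \<Omega>)"
    unfolding v_def using u by (rule two_point_in_borel_L2)
  have pol: "bounded (polarization {x. a \<bullet> x < b} \<Omega>)" "polarization {x. a \<bullet> x < b} \<Omega> \<in> sets borel"
    using bounded_polarization[OF \<Omega>(1)] open_polarization[OF \<Omega>(2)] by auto
  have Su: "integrable (lborel \<Otimes>\<^sub>M lborel) (S u)"
      "integral\<^sup>L (lborel \<Otimes>\<^sub>M lborel) (S u) = 4 * riesz_form \<beta> u u"
    unfolding S_def[abs_def]
    by (rule riesz_form_symmetrized[OF riesz_form_integrable[OF \<beta> \<Omega>(1) \<Omega>' u(1) u(1)]])+
  have Sv: "integrable (lborel \<Otimes>\<^sub>M lborel) (S v)"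
      "integral\<^sup>L (lborel \<Otimes>\<^sub>M lborel) (S v) = 4 * riesz_form \<beta> v v"
    unfolding S_def[abs_def]
    by (rule riesz_form_symmetrized[OF riesz_form_integrable[OF \<beta> pol v v]])+
  have ui: "integrable lborel u"
    using borel_L2_integrable[OF u(1) \<Omega>(1) \<Omega>'] .
  then have u\<sigma>: "integrable lborel (\<lambda>y. u (\<sigma> y))"
    using integral_mirror(2)[OF um] by simp
  have restricted: "integrable lborel (\<lambda>x. u x * indicator A x)"
      "integrable lborel (\<lambda>y. u (\<sigma> y) * indicator B y)"
    using integrable_mult_indicator[OF _ ui, of A] integrable_mult_indicator[OF _ u\<sigma>, of B] A(1) B(1)
    by (simp_all add: mult.commute)
  note tensor = integrable_tensor[OF restricted]
  have Gi: "integrable (lborel \<Otimes>\<^sub>M lborel) G"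
    unfolding G_def[abs_def] using tensor(1) by simp
  have "AE z in lborel \<Otimes>\<^sub>M lborel. snd z \<noteq> fst (z :: 'a \<times> 'a)"
    using AE_off_graph[of "\<lambda>x::'a. x"] by simp
  moreover have "AE z in lborel \<Otimes>\<^sub>M lborel. snd z \<noteq> \<sigma> (fst (z :: 'a \<times> 'a))"
    using AE_off_graph[OF mirror_measurable] .
  ultimately have le: "AE z in lborel \<Otimes>\<^sub>M lborel. S u z + G z \<le> S v z"
  proof eventually_elim
    case (elim z)
    show ?case
    proof (cases "fst z \<in> A \<and> snd z \<in> B")
      case True
      have "u (\<sigma> (fst z)) = 0" "u (snd z) = 0"
        using True A(2) B(2) borel_L2_zero[OF u(1)] by blast+
      then show ?thesis
        using symmetrized_gain[OF u(2), where x = "fst z" and y = "snd z" and c = c and \<beta> = \<beta>] True A(2) B(2) c elim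
        by (simp add: S_def G_def v_def)
    next
      case False
      then have "G z = 0"
        by (auto simp: G_def)
      then show ?thesis
        using symmetrized_mono[OF \<beta>(1), where x = "fst z" and y = "snd z" and u = u] elim by (simp add: S_def v_def)
    qed
  qed
  have "integral\<^sup>L (lborel \<Otimes>\<^sub>M lborel) (\<lambda>z. S u z + G z) \<le> integral\<^sup>L (lborel \<Otimes>\<^sub>M lborel) (S v)"
    using Su(1) Sv(1) Gi le by (intro integral_mono_AE) auto
  moreover have "integral\<^sup>L (lborel \<Otimes>\<^sub>M lborel) (\<lambda>z. S u z + G z)
      = integral\<^sup>L (lborel \<Otimes>\<^sub>M lborel) (S u) + integral\<^sup>L (lborel \<Otimes>\<^sub>M lborel) G"
    using Su(1) Gi by simp
  moreover have "integral\<^sup>L (lborel \<Otimes>\<^sub>M lborel) G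
      = c * ((LINT x|lborel. u x * indicator A x) * (LINT y|lborel. u (\<sigma> y) * indicator B y))"
    unfolding G_def[abs_def] using tensor by simp
  ultimately show ?thesis
    using Su(2) Sv(2) by (simp add: v_def)
qed

end

section \<open>Polarization and the first eigenvalue\<close>

context
  fixes a :: "'a::euclidean_space" and b :: real
  assumes a: "a \<noteq> 0"
begin

lemma null_set_from_half:
  assumes N: "N \<in> sets borel" "emeasure lborel N = 0"
    and S: "S \<in> sets borel" "\<And>x. x \<in> S \<Longrightarrow> x \<in> N \<or> mirror a b x \<in> N"
  shows "S \<in> null_sets lebesgue"
proof -
  let ?N' = "{x. mirror a b x \<in> N}"
  note [measurable] = N(1) mirror_measurable[OF a]
  have N': "?N' \<in> sets borel"
    by measurable
  have "N \<in> null_sets lborel" "?N' \<in> null_sets lborel"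
    using N N' emeasure_mirror[OF a N(1)] by (simp_all add: null_sets_def)
  then have "N \<union> ?N' \<in> null_sets lborel"
    by (rule null_sets.Un)
  then have "S \<in> null_sets lborel"
    by (rule null_sets_subset) (use S in auto)
  then show ?thesis
    by (rule null_sets_completionI)
qed

text \<open>The open half-space is the union of countably many closed half-spaces, so not all parts of \<open>N\<close> in
them can be null.\<close>

lemma positive_part_off_hyperplane:
  assumes N: "N \<in> sets borel" "N \<subseteq> {x. a \<bullet> x < b}" "emeasure lborel N \<noteq> 0"
  obtains s where "0 < s" "emeasure lborel (N \<inter> {x. a \<bullet> x \<le> b - s}) \<noteq> 0"
proof -
  let ?N = "\<lambda>n. N \<inter> {x. a \<bullet> x \<le> b - inverse (real (Suc n))}"
  have "\<exists>n. emeasure lborel (?N n) \<noteq> 0"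
  proof (rule ccontr)
    assume "\<not> ?thesis"
    moreover have "?N n \<in> sets borel" for n
      using N(1) by (intro sets.Int) (simp_all add: borel_closed closed_halfspace_le)
    ultimately have "(\<Union>n. ?N n) \<in> null_sets lborel"
      by (intro null_sets_UN) (auto simp: null_sets_def)
    moreover have "(\<Union>n. ?N n) = N"
    proof -
      have "\<exists>n. a \<bullet> x \<le> b - inverse (real (Suc n))" if "x \<in> N" for x
      proof -
        have "0 < b - a \<bullet> x"
          using that N(2) by auto
        then obtain n where "inverse (real (Suc n)) < b - a \<bullet> x"
          using reals_Archimedean by blast
        then show ?thesis
          by (intro exI[of _ n]) linarith
      qed
      then show ?thesis by auto
    qed
    ultimately show False
      using N(3) by (simp add: null_sets_def)
  qed
  then obtain n where "emeasure lborel (?N n) \<noteq> 0" ..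
  then show thesis
    by (intro that[of "inverse (real (Suc n))"]) simp_all
qed

context
  fixes \<alpha> :: real and \<Omega> :: "'a set"
  assumes \<alpha>: "0 < \<alpha>" "\<alpha> < real DIM('a)" and \<Omega>: "bounded \<Omega>" "open \<Omega>"
begin

lemma riesz_lambda1_polarization_mono:
  assumes "\<Omega> \<noteq> {}"
  shows "riesz_lambda1 \<alpha> \<Omega> \<le> riesz_lambda1 \<alpha> (polarization {x. a \<bullet> x < b} \<Omega>)"
proof (rule field_le_epsilon)
  fix \<delta> :: real assume "0 < \<delta>"
  let ?P = "polarization {x. a \<bullet> x < b} \<Omega>"
  define \<beta> where "\<beta> = real DIM('a) - \<alpha>"
  have \<beta>: "0 < \<beta>" "\<beta> < real DIM('a)"
    using \<alpha> by (auto simp: \<beta>_def)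
  obtain u where u: "u \<in> borel_L2 \<Omega>" "\<And>x. 0 \<le> u x" "(LINT x|lborel. (u x)\<^sup>2) = 1"
    "riesz_lambda1 \<alpha> \<Omega> - \<delta> < riesz_form \<beta> u u"
    using ex_near_maximizer[OF \<alpha> \<beta>_def \<Omega> assms \<open>0 < \<delta>\<close>] by metis
  let ?v = "two_point a b u"
  have "riesz_form \<beta> u u \<le> riesz_form \<beta> ?v ?v"
    using riesz_form_two_point[OF a \<beta> \<Omega> u(1,2), where A = "{}" and B = "{}" and c = 0] by simp
  also have "\<dots> \<le> riesz_lambda1 \<alpha> ?P * (LINT x|lborel. (?v x)\<^sup>2)"
    by (rule riesz_form_le_lambda1[OF \<alpha> \<beta>_def bounded_polarization[OF a \<Omega>(1)]
          open_polarization[OF a \<Omega>(2)] two_point_in_borel_L2[OF a u(1,2)]])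
  also have "(LINT x|lborel. (?v x)\<^sup>2) = 1"
    using two_point_integral_square(2)[OF a borel_L2_measurable[OF u(1)] borel_L2_square[OF u(1)]] u(3)
    by simp
  finally show "riesz_lambda1 \<alpha> \<Omega> \<le> riesz_lambda1 \<alpha> ?P + \<delta>"
    using u(4) by simp
qed

text \<open>The two sets are the parts of \<open>H\<close> where polarization keeps a point of \<open>\<Omega>\<close> without its mirror image
and where it moves a point of \<open>\<Omega>\<close> across the hyperplane. Every nearly optimal function has a
definite mass on the first set and on the mirror image of the second one, and rearranging brings
these masses closer together.\<close>

lemma riesz_lambda1_polarization_strict:
  assumes A: "emeasure lborel {x. a \<bullet> x < b \<and> x \<in> \<Omega> \<and> mirror a b x \<notin> \<Omega>} \<noteq> 0"
    and B: "emeasure lborel {x. a \<bullet> x < b \<and> x \<notin> \<Omega> \<and> mirror a b x \<in> \<Omega>} \<noteq> 0"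
  shows "riesz_lambda1 \<alpha> \<Omega> < riesz_lambda1 \<alpha> (polarization {x. a \<bullet> x < b} \<Omega>)"
proof -
  let ?P = "polarization {x. a \<bullet> x < b} \<Omega>"
  define \<beta> where "\<beta> = real DIM('a) - \<alpha>"
  have \<beta>: "0 < \<beta>" "\<beta> < real DIM('a)"
    using \<alpha> by (auto simp: \<beta>_def)
  note [measurable] = mirror_measurable[OF a, of b]
  have [measurable]: "\<Omega> \<in> sets borel"
    using \<Omega>(2) by simp
  have ne: "\<Omega> \<noteq> {}"
    using A by auto
  have P: "bounded ?P" "open ?P"
    by (rule bounded_polarization[OF a \<Omega>(1)], rule open_polarization[OF a \<Omega>(2)])
  obtain s1 where s1: "0 < s1" "emeasure lborel
      ({x. a \<bullet> x < b \<and> x \<in> \<Omega> \<and> mirror a b x \<notin> \<Omega>} \<inter> {x. a \<bullet> x \<le> b - s1}) \<noteq> 0"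
    by (rule positive_part_off_hyperplane[OF _ _ A]) (measurable, auto)
  obtain s2 where s2: "0 < s2" "emeasure lborel
      ({x. a \<bullet> x < b \<and> x \<notin> \<Omega> \<and> mirror a b x \<in> \<Omega>} \<inter> {x. a \<bullet> x \<le> b - s2}) \<noteq> 0"
    by (rule positive_part_off_hyperplane[OF _ _ B]) (measurable, auto)
  define A' where "A' = {x. a \<bullet> x < b \<and> x \<in> \<Omega> \<and> mirror a b x \<notin> \<Omega> \<and> a \<bullet> x \<le> b - s1}"
  define B' where "B' = {x. a \<bullet> x < b \<and> x \<notin> \<Omega> \<and> mirror a b x \<in> \<Omega> \<and> a \<bullet> x \<le> b - s2}"
  \<comment> \<open>The functions live on \<open>\<Omega>\<close>, which contains the mirror image of \<open>B'\<close> rather than \<open>B'\<close> itself.\<close>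
  define C where "C = {x. mirror a b x \<in> B'}"
  have A'm [measurable]: "A' \<in> sets borel" and B'm [measurable]: "B' \<in> sets borel"
    unfolding A'_def B'_def by measurable
  have Cm: "C \<in> sets borel"
    unfolding C_def by measurable
  have C\<Omega>: "C \<subseteq> \<Omega>"
    by (auto simp: C_def B'_def mirror_mirror[OF a])
  have A'\<Omega>: "A' \<subseteq> \<Omega>"
    by (auto simp: A'_def)
  have fin: "emeasure lborel A' < \<infinity>" "emeasure lborel C < \<infinity>"
    using \<Omega>(1) A'\<Omega> C\<Omega> bounded_subset by (blast intro: emeasure_bounded_finite)+
  have "emeasure lborel A' \<noteq> 0"
    using s1(2) by (simp add: A'_def Collect_conj_eq[symmetric] conj_ac)
  then have A'pos: "0 < measure lborel A'"
    using fin by (simp add: emeasure_eq_ennreal_measure zero_less_measure_iff)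
  have "emeasure lborel C \<noteq> 0"
    using s2(2) emeasure_mirror[OF a B'm, of b]
    by (simp add: C_def B'_def Collect_conj_eq[symmetric] conj_ac)
  then have Cpos: "0 < measure lborel C"
    using fin by (simp add: emeasure_eq_ennreal_measure zero_less_measure_iff)
  obtain D where D: "0 < D" "\<And>x y. x \<in> ?P \<Longrightarrow> y \<in> ?P \<Longrightarrow> norm (x - y) \<le> D"
    using bounded_norm_diff_le[OF P(1)] by metis
  \<comment> \<open>By \<open>mirror_dist_square\<close>, reflecting \<open>y\<close> increases the squared distance to \<open>x\<close> by at least \<open>h\<close>.\<close>
  define h where "h = 4 * (s1 * s2) / (a \<bullet> a)"
  have h: "0 < h"
    using s1(1) s2(1) a by (simp add: h_def)
  define c where "c = 1 / D powr \<beta> * (1 - sqrt (D\<^sup>2 / (D\<^sup>2 + h)) powr \<beta>)"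
  have gap: "c \<le> 1 / norm (x - y) powr \<beta> - 1 / norm (x - mirror a b y) powr \<beta>"
    if x: "x \<in> A'" and y: "y \<in> B'" and "x \<noteq> y" for x y
  proof -
    have "s1 * s2 \<le> (b - a \<bullet> x) * (b - a \<bullet> y)"
      using x y s1(1) s2(1) by (intro mult_mono) (auto simp: A'_def B'_def)
    also have "\<dots> = (a \<bullet> x - b) * (a \<bullet> y - b)"
      by (simp add: algebra_simps)
    finally have "h \<le> 4 * ((a \<bullet> x - b) * (a \<bullet> y - b)) / (a \<bullet> a)"
      unfolding h_def by (intro divide_right_mono) auto
    then have le: "(norm (x - y))\<^sup>2 + h \<le> (norm (x - mirror a b y))\<^sup>2"
      unfolding mirror_dist_square[OF a] by simp
    moreover have "0 < (norm (x - y))\<^sup>2 + h"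
      using h by (simp add: add_nonneg_pos)
    ultimately have "0 < norm (x - mirror a b y)"
      by (metis norm_ge_zero less_le_trans zero_less_power2 order_le_less)
    moreover have "norm (x - y) \<le> D"
      using x y by (intro D(2)) (auto simp: A'_def B'_def mem_polarization[OF a])
    ultimately show ?thesis
      unfolding c_def using inverse_powr_gap_ge[OF _ _ h \<beta>(1) le] \<open>x \<noteq> y\<close> by simp
  qed
  have c: "0 < c"
    unfolding c_def by (rule inverse_powr_gap_pos[OF D(1) h \<beta>(1)])
  obtain m1 \<delta>1 where m1: "0 < m1" "0 < \<delta>1"
    "\<forall>u\<in>borel_L2 \<Omega>. (\<forall>x. 0 \<le> u x) \<and> (LINT x|lborel. (u x)\<^sup>2) = 1
        \<and> riesz_lambda1 \<alpha> \<Omega> - \<delta>1 \<le> riesz_form \<beta> u u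
      \<longrightarrow> m1 \<le> (LINT x|lborel. u x * indicator A' x)"
    using near_maximizer_mass[OF \<alpha> \<beta>_def \<Omega> A'm A'\<Omega> A'pos] by blast
  obtain m2 \<delta>2 where m2: "0 < m2" "0 < \<delta>2"
    "\<forall>u\<in>borel_L2 \<Omega>. (\<forall>x. 0 \<le> u x) \<and> (LINT x|lborel. (u x)\<^sup>2) = 1
        \<and> riesz_lambda1 \<alpha> \<Omega> - \<delta>2 \<le> riesz_form \<beta> u u
      \<longrightarrow> m2 \<le> (LINT x|lborel. u x * indicator C x)"
    using near_maximizer_mass[OF \<alpha> \<beta>_def \<Omega> Cm C\<Omega> Cpos] by blast
  define \<delta> where "\<delta> = min (min \<delta>1 \<delta>2) (c / 4 * (m1 * m2))"
  have \<delta>: "0 < \<delta>" "\<delta> \<le> \<delta>1" "\<delta> \<le> \<delta>2" "\<delta> \<le> c / 4 * (m1 * m2)"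
    using m1 m2 c by (auto simp: \<delta>_def)
  obtain u where u: "u \<in> borel_L2 \<Omega>" "\<And>x. 0 \<le> u x" "(LINT x|lborel. (u x)\<^sup>2) = 1"
    "riesz_lambda1 \<alpha> \<Omega> - \<delta> < riesz_form \<beta> u u"
    using ex_near_maximizer[OF \<alpha> \<beta>_def \<Omega> ne \<delta>(1)] by metis
  let ?v = "two_point a b u"
  have "m1 \<le> (LINT x|lborel. u x * indicator A' x)"
    using bspec[OF m1(3) u(1)] u(2-4) \<delta>(2) by simp
  moreover have "m2 \<le> (LINT y|lborel. u (mirror a b y) * indicator B' y)"
  proof -
    have [measurable]: "u \<in> borel_measurable borel"
      by (rule borel_L2_measurable[OF u(1)])
    have "(LINT y|lborel. u (mirror a b y) * indicator B' y)
        = (LINT y|lborel. (\<lambda>x. u x * indicator B' (mirror a b x)) (mirror a b y))"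
      by (simp add: mirror_mirror[OF a])
    also have "\<dots> = (LINT x|lborel. u x * indicator B' (mirror a b x))"
      by (rule integral_mirror(1)[OF a]) measurable
    also have "\<dots> = (LINT x|lborel. u x * indicator C x)"
      by (simp add: C_def indicator_def)
    finally show ?thesis
      using bspec[OF m2(3) u(1)] u(2-4) \<delta>(3) by simp
  qed
  ultimately have "m1 * m2 \<le> (LINT x|lborel. u x * indicator A' x)
      * (LINT y|lborel. u (mirror a b y) * indicator B' y)"
    using m1(1) m2(1) by (intro mult_mono) auto
  then have "\<delta> \<le> c / 4 * ((LINT x|lborel. u x * indicator A' x)
      * (LINT y|lborel. u (mirror a b y) * indicator B' y))"
    using \<delta>(4) c by (meson divide_nonneg_nonneg less_imp_le mult_left_mono order_trans zero_le_numeral)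
  then have "riesz_lambda1 \<alpha> \<Omega> < riesz_form \<beta> u u
      + c / 4 * ((LINT x|lborel. u x * indicator A' x)
      * (LINT y|lborel. u (mirror a b y) * indicator B' y))"
    using u(4) by linarith
  also have "\<dots> \<le> riesz_form \<beta> ?v ?v"
    by (rule riesz_form_two_point[OF a \<beta> \<Omega> u(1,2) A'm _ B'm _ gap])
      (auto simp: A'_def B'_def)
  also have "\<dots> \<le> riesz_lambda1 \<alpha> ?P * (LINT x|lborel. (?v x)\<^sup>2)"
    by (rule riesz_form_le_lambda1[OF \<alpha> \<beta>_def P two_point_in_borel_L2[OF a u(1,2)]])
  also have "(LINT x|lborel. (?v x)\<^sup>2) = 1"
    using two_point_integral_square(2)[OF a borel_L2_measurable[OF u(1)] borel_L2_square[OF u(1)]] u(3)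
    by simp
  finally show ?thesis
    by simp
qed

end

text \<open>A point where the polarized set differs from \<open>\<Omega>\<close> lies in the first of the two exceptional sets or
is the mirror image of one of its points; likewise for the reflected set and the second one.\<close>

lemma polarization_almost_equal:
  assumes \<Omega>: "open \<Omega>"
  shows "emeasure lborel {x. a \<bullet> x < b \<and> x \<notin> \<Omega> \<and> mirror a b x \<in> \<Omega>} = 0
      \<Longrightarrow> polarization {x. a \<bullet> x < b} \<Omega> \<cong>\<^sub>m \<Omega>"
    and "emeasure lborel {x. a \<bullet> x < b \<and> x \<in> \<Omega> \<and> mirror a b x \<notin> \<Omega>} = 0
      \<Longrightarrow> polarization {x. a \<bullet> x < b} \<Omega> \<cong>\<^sub>m mirror a b ` \<Omega>"
proof -
  let ?P = "polarization {x. a \<bullet> x < b} \<Omega>"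
  note [measurable] = mirror_measurable[OF a, of b]
  have [measurable]: "\<Omega> \<in> sets borel" and P: "?P \<in> sets borel" and \<sigma>\<Omega>: "mirror a b ` \<Omega> \<in> sets borel"
    using \<Omega> open_polarization[OF a \<Omega>] open_mirror_image[OF a \<Omega>] by auto
  have hyperplane: "a \<bullet> x < b \<or> a \<bullet> mirror a b x < b \<or> mirror a b x = x" for x
    using mirror_side[OF a, of b x] mirror_on_hyperplane[OF a, of x b] by (metis linorder_less_linear)
  show "?P \<cong>\<^sub>m \<Omega>" if "emeasure lborel {x. a \<bullet> x < b \<and> x \<notin> \<Omega> \<and> mirror a b x \<in> \<Omega>} = 0"
    unfolding almost_equal_def
  proof (rule null_set_from_half[OF _ that])
    show "x \<in> {x. a \<bullet> x < b \<and> x \<notin> \<Omega> \<and> mirror a b x \<in> \<Omega>}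
        \<or> mirror a b x \<in> {x. a \<bullet> x < b \<and> x \<notin> \<Omega> \<and> mirror a b x \<in> \<Omega>}"
      if "x \<in> sym_diff ?P \<Omega>" for x
      using that hyperplane[of x] by (auto simp: mem_polarization[OF a] mirror_mirror[OF a] split: if_splits)
  qed (use P \<Omega> in auto)
  show "?P \<cong>\<^sub>m mirror a b ` \<Omega>" if "emeasure lborel {x. a \<bullet> x < b \<and> x \<in> \<Omega> \<and> mirror a b x \<notin> \<Omega>} = 0"
    unfolding almost_equal_def
  proof (rule null_set_from_half[OF _ that])
    show "x \<in> {x. a \<bullet> x < b \<and> x \<in> \<Omega> \<and> mirror a b x \<notin> \<Omega>}
        \<or> mirror a b x \<in> {x. a \<bullet> x < b \<and> x \<in> \<Omega> \<and> mirror a b x \<notin> \<Omega>}"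
      if "x \<in> sym_diff ?P (mirror a b ` \<Omega>)" for x
      using that hyperplane[of x]
      by (simp add: mem_polarization[OF a] mirror_mirror[OF a] mem_mirror_image[OF a] split: if_splits) auto
  qed (use P \<sigma>\<Omega> in auto)
qed

end

theorem theorem5p2:
  fixes \<Omega> H :: "(real ^ 'n) set" and \<alpha> :: real
  assumes "CARD('n) \<ge> 2"
    and "0 < \<alpha>" and "\<alpha> < real CARD('n)"
    and "bounded \<Omega>" and "open \<Omega>"
    and "polarizer H"
  shows "riesz_lambda1 \<alpha> \<Omega> \<le> riesz_lambda1 \<alpha> (polarization H \<Omega>) \<and>
         (riesz_lambda1 \<alpha> \<Omega> = riesz_lambda1 \<alpha> (polarization H \<Omega>) \<longrightarrow>
            polarization H \<Omega> \<cong>\<^sub>m \<Omega> \<or> polarization H \<Omega> \<cong>\<^sub>m reflect_bdry H ` \<Omega>)"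
proof (cases "\<Omega> = {}")
  case True
  then show ?thesis
    by (simp add: polarization_def almost_equal_def)
next
  case False
  obtain a b where a: "a \<noteq> 0" and H: "H = {x. a \<bullet> x < b}"
    using assms(6) by (auto simp: polarizer_def)
  have \<alpha>: "0 < \<alpha>" "\<alpha> < real DIM(real ^ 'n)"
    using assms(2,3) by simp_all
  have "riesz_lambda1 \<alpha> \<Omega> \<le> riesz_lambda1 \<alpha> (polarization H \<Omega>)"
    unfolding H by (rule riesz_lambda1_polarization_mono[OF a \<alpha> assms(4,5) False])
  moreover have "polarization H \<Omega> \<cong>\<^sub>m \<Omega> \<or> polarization H \<Omega> \<cong>\<^sub>m reflect_bdry H ` \<Omega>"
    if "riesz_lambda1 \<alpha> \<Omega> = riesz_lambda1 \<alpha> (polarization H \<Omega>)"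
    using that riesz_lambda1_polarization_strict[OF a \<alpha> assms(4,5), of b]
      polarization_almost_equal[OF a assms(5), of b]
    unfolding H reflect_bdry_eq_mirror[OF a] by fastforce
  ultimately show ?thesis
    by blast
qed

end
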